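(* Let $n\ge 1$ and let $A_n$ be the group of permutations of $[n+1]=\{1,\dots,n+1\}$, with Coxeter generators $s_i=(i,i+1)$, $1\le i\le n$. Let $\pi,\rho\in A_n$ be two boolean permutations such that $\pi\le\rho$ in the Bruhat order. Then the ordinary Kazhdan--Lusztig polynomial is $$P_{\pi,\rho}(q)=(1+q)^{\#A_{\pi,\rho}},$$ where $$A_{\pi,\rho}=\{i\in[n] : i\in \mathrm{NFix}(\rho),\ i+1\in\mathrm{NFix}(\rho),\ i+1\in\mathrm{Fix}(\pi)\}.$$
   Context: $[m]=\{1,\dots,m\}$. For $\sigma\in A_n$: $\mathrm{Fix}(\sigma)=\{i\in[n] : \sigma([i])=[i]\}$ and $\mathrm{NFix}(\sigma)=\{i\in[n]\setminus\mathrm{Fix}(\sigma) : \sigma(i+1)=i+1\}$. A boolean reflection in a Coxeter system $(W,S)$ is a reflection having a reduced expression $r_1\cdots r_{k-1}r_kr_{k-1}\cdots r_1$ with $r_1,\dots,r_k\in S$ pairwise distinct; an element is boolean if it is below some boolean reflection in Bruhat order. In $A_n$ this is equivalent to being $\le$ the transposition $(1,n+1)=s_1\cdots s_{n-1}s_ns_{n-1}\cdots s_1$. *)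

theory Defs
  imports "HOL-Algebra.Sym_Groups" "HOL-Computational_Algebra.Polynomial"
begin

section \<open>Combinatorics of a group with a distinguished generating set\<close>

text \<open>
  Throughout, \<open>G\<close> is a group and \<open>S\<close> a subset of its carrier; the notions below are the usual ones
  when \<open>(G, S)\<close> is a Coxeter system.
\<close>

definition word_prod :: "('a, 'b) monoid_scheme \<Rightarrow> 'a list \<Rightarrow> 'a" where
  "word_prod G ws = foldr (\<lambda>x y. x \<otimes>\<^bsub>G\<^esub> y) ws \<one>\<^bsub>G\<^esub>"

definition cox_length :: "('a, 'b) monoid_scheme \<Rightarrow> 'a set \<Rightarrow> 'a \<Rightarrow> nat" where
  "cox_length G S w = (LEAST k. \<exists>ws. set ws \<subseteq> S \<and> length ws = k \<and> word_prod G ws = w)"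

definition reduced_expression :: "('a, 'b) monoid_scheme \<Rightarrow> 'a set \<Rightarrow> 'a list \<Rightarrow> 'a \<Rightarrow> bool" where
  "reduced_expression G S ws w \<longleftrightarrow>
     set ws \<subseteq> S \<and> word_prod G ws = w \<and> length ws = cox_length G S w"

definition reflections :: "('a, 'b) monoid_scheme \<Rightarrow> 'a set \<Rightarrow> 'a set" where
  "reflections G S = {w \<otimes>\<^bsub>G\<^esub> s \<otimes>\<^bsub>G\<^esub> inv\<^bsub>G\<^esub> w | w s. w \<in> carrier G \<and> s \<in> S}"

definition bruhat_step :: "('a, 'b) monoid_scheme \<Rightarrow> 'a set \<Rightarrow> 'a \<Rightarrow> 'a \<Rightarrow> bool" where
  "bruhat_step G S u v \<longleftrightarrow>
     u \<in> carrier G \<and> (\<exists>t \<in> reflections G S. v = u \<otimes>\<^bsub>G\<^esub> t) \<and> cox_length G S u < cox_length G S v"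

definition bruhat_le :: "('a, 'b) monoid_scheme \<Rightarrow> 'a set \<Rightarrow> 'a \<Rightarrow> 'a \<Rightarrow> bool" where
  "bruhat_le G S u v \<longleftrightarrow> u \<in> carrier G \<and> v \<in> carrier G \<and> (bruhat_step G S)\<^sup>*\<^sup>* u v"

definition right_descents :: "('a, 'b) monoid_scheme \<Rightarrow> 'a set \<Rightarrow> 'a \<Rightarrow> 'a set" where
  "right_descents G S w = {s \<in> S. cox_length G S (w \<otimes>\<^bsub>G\<^esub> s) < cox_length G S w}"


section \<open>Boolean reflections and boolean elements\<close>

definition boolean_reflection :: "('a, 'b) monoid_scheme \<Rightarrow> 'a set \<Rightarrow> 'a \<Rightarrow> bool" where
  "boolean_reflection G S t \<longleftrightarrow>
     t \<in> reflections G S \<and>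
     (\<exists>rs r. distinct (rs @ [r]) \<and> reduced_expression G S (rs @ [r] @ rev rs) t)"

definition boolean_element :: "('a, 'b) monoid_scheme \<Rightarrow> 'a set \<Rightarrow> 'a \<Rightarrow> bool" where
  "boolean_element G S w \<longleftrightarrow> (\<exists>t. boolean_reflection G S t \<and> bruhat_le G S w t)"


section \<open>Kazhdan--Lusztig polynomials\<close>

text \<open>
  The \<open>R\<close>-polynomials and the Kazhdan--Lusztig polynomials are each the unique family of integer
  polynomials with the properties below (Kazhdan and Lusztig; see Bjoerner and Brenti,
  \<^emph>\<open>Combinatorics of Coxeter Groups\<close>, Theorems 5.1.1 and 5.1.4). The polynomial \<open>[:0, 1:]\<close> is the
  indeterminate \<open>q\<close> and \<open>[:-1, 1:]\<close> is \<open>q - 1\<close>. The vanishing clauses also fix the value of a family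
  at arguments outside the carrier, so that uniqueness holds for total functions.
\<close>

definition R_family ::
  "('a, 'b) monoid_scheme \<Rightarrow> 'a set \<Rightarrow> ('a \<Rightarrow> 'a \<Rightarrow> int poly) \<Rightarrow> bool" where
  "R_family G S R \<longleftrightarrow>
     (\<forall>u v. \<not> bruhat_le G S u v \<longrightarrow> R u v = 0) \<and>
     (\<forall>u \<in> carrier G. R u u = 1) \<and>
     (\<forall>u \<in> carrier G. \<forall>v \<in> carrier G. \<forall>s \<in> right_descents G S v.
        R u v =
          (if s \<in> right_descents G S u then R (u \<otimes>\<^bsub>G\<^esub> s) (v \<otimes>\<^bsub>G\<^esub> s)
           else [:0, 1:] * R (u \<otimes>\<^bsub>G\<^esub> s) (v \<otimes>\<^bsub>G\<^esub> s) + [:-1, 1:] * R u (v \<otimes>\<^bsub>G\<^esub> s)))"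

definition R_poly :: "('a, 'b) monoid_scheme \<Rightarrow> 'a set \<Rightarrow> 'a \<Rightarrow> 'a \<Rightarrow> int poly" where
  "R_poly G S = (THE R. R_family G S R)"

text \<open>For \<open>degree p \<le> d\<close>, the polynomial \<open>reverse_at d p\<close> is $q^d\, p(1/q)$.\<close>

definition reverse_at :: "nat \<Rightarrow> int poly \<Rightarrow> int poly" where
  "reverse_at d p = (\<Sum>i\<le>d. monom (coeff p i) (d - i))"

text \<open>
  The degree bound $\deg P_{u,v} \le (\ell(v) - \ell(u) - 1)/2$ for $u < v$ is stated free of division.
\<close>

definition KL_family ::
  "('a, 'b) monoid_scheme \<Rightarrow> 'a set \<Rightarrow> ('a \<Rightarrow> 'a \<Rightarrow> int poly) \<Rightarrow> bool" where
  "KL_family G S P \<longleftrightarrow>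
     (\<forall>u v. \<not> bruhat_le G S u v \<longrightarrow> P u v = 0) \<and>
     (\<forall>u \<in> carrier G. P u u = 1) \<and>
     (\<forall>u v. bruhat_le G S u v \<and> u \<noteq> v \<longrightarrow>
        2 * degree (P u v) + 1 \<le> cox_length G S v - cox_length G S u) \<and>
     (\<forall>u v. bruhat_le G S u v \<longrightarrow>
        reverse_at (cox_length G S v - cox_length G S u) (P u v) =
          (\<Sum>z | bruhat_le G S u z \<and> bruhat_le G S z v. R_poly G S u z * P z v))"

definition KL_poly :: "('a, 'b) monoid_scheme \<Rightarrow> 'a set \<Rightarrow> 'a \<Rightarrow> 'a \<Rightarrow> int poly" where
  "KL_poly G S = (THE P. KL_family G S P)"


section \<open>The symmetric group\<close>

text \<open>
  The group of type $A_n$ is \<open>sym_group (n + 1)\<close>: its elements are the functions permuting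
  \<open>{1..n + 1}\<close> (and fixing every other natural number), multiplied by composition.
\<close>

definition simple_transpositions :: "nat \<Rightarrow> (nat \<Rightarrow> nat) set" where
  "simple_transpositions n = (\<lambda>i. transpose i (i + 1)) ` {1..n}"

definition Fix :: "nat \<Rightarrow> (nat \<Rightarrow> nat) \<Rightarrow> nat set" where
  "Fix n \<sigma> = {i \<in> {1..n}. \<sigma> ` {1..i} = {1..i}}"

definition NFix :: "nat \<Rightarrow> (nat \<Rightarrow> nat) \<Rightarrow> nat set" where
  "NFix n \<sigma> = {i \<in> {1..n} - Fix n \<sigma>. \<sigma> (i + 1) = i + 1}"

definition A_set :: "nat \<Rightarrow> (nat \<Rightarrow> nat) \<Rightarrow> (nat \<Rightarrow> nat) \<Rightarrow> nat set" where
  "A_set n \<pi> \<rho> = {i \<in> {1..n}. i \<in> NFix n \<rho> \<and> i + 1 \<in> NFix n \<rho> \<and> i + 1 \<in> Fix n \<pi>}"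

end

(* Identify functions on the group with elements of the Hecke algebra. The R-polynomials are, up to
   sign, the coordinates of the inverses of the standard basis, and the defining identity of the
   Kazhdan-Lusztig polynomials P(-, v) says that this column is fixed by the bar involution.
   Together with the degree bound and P(v, v) = 1, this determines the column, so it suffices to
   check that c_v(u) = (1+q)^#A(u,v) for u <= v (and 0 otherwise) has these properties.

   Self-duality is preserved by left and right multiplication by T_s + 1. The elements below (k, n+1)
   are w, s w, w s and s w s with s = s_k and w below (k+1, n+1). The columns of w s and s w are
   obtained from that of w by one multiplication by T_s + 1. If w moves k+1, two multiplications
   give a column whose entries with k+1 in Fix(u) carry an additional factor 1+q. If k+1 lies in
   NFix(w), this is the column of s w s. Otherwise w = y s' or w = s' y with s' = s_{k+1} and y below
   (k+2, n+1), and the surplus is exactly q times the column of y s. *)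

theory Submission
  imports Defs
begin

section \<open>Reversal of polynomials\<close>

text \<open>\<open>R_poly\<close> and \<open>KL_poly\<close> are definite descriptions, so a formula
  for boolean columns acquires meaning only once both families are known to exist and to be unique
  on the whole group, the non-boolean columns included. This forces a general existence proof next
  to the explicit verification. The factor 1+q after two multiplications has a combinatorial source:
  the lower interval of w s and its left translate by s overlap, namely in the elements u with k+1
  in Fix(u). When w moves k+1, passing to s w s puts k into NFix; if k+1 is there already, the set A
  gains k exactly on the overlap and absorbs the factor. The degree then rises by one while elements
  u = x s of the overlap use up length, so the ordinary degree bound for x is short by one; this is
  why a bound sharper by one travels along the induction. In the remaining case the overlap is the
  lower interval of y s, where (1+q)^(a+1) - q (1+q)^a = (1+q)^a. The subtraction respects
  self-duality because y s is two shorter than s w s, which is the shift caused by a factor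
  q.\<close>

definition q :: "int poly" where "q = [:0, 1:]"

lemma coeff_q_mult: "coeff (q * p) i = (case i of 0 \<Rightarrow> 0 | Suc j \<Rightarrow> coeff p j)"
  by (simp add: q_def coeff_pCons)

lemma q_neq_0 [simp]: "q \<noteq> 0"
  by (simp add: q_def)

lemma q_eq_monom: "q = monom 1 1"
  by (simp add: q_def monom_altdef)

lemma degree_q_mult_le: "degree p \<le> d \<Longrightarrow> degree (q * p) \<le> Suc d"
  by (simp add: q_def degree_pCons_le le_trans [OF degree_pCons_le])

lemma coeff_power_q_mult: "coeff (q ^ k * p) i = (if i < k then 0 else coeff p (i - k))"
proof -
  have "q ^ k = monom 1 k"
    by (simp add: q_eq_monom monom_power)
  then show ?thesis
    by (simp add: coeff_monom_mult)
qed

lemma coeff_reverse_at: "coeff (reverse_at d p) i = (if i \<le> d then coeff p (d - i) else 0)"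
proof -
  have "coeff (reverse_at d p) i = (\<Sum>j\<le>d. if d - j = i then coeff p j else 0)"
    by (simp add: reverse_at_def coeff_sum)
  also have "\<dots> = (\<Sum>j\<le>d. if j = d - i \<and> i \<le> d then coeff p j else 0)"
    by (intro sum.cong) auto
  also have "\<dots> = (if i \<le> d then coeff p (d - i) else 0)"
    by (auto simp: sum.delta)
  finally show ?thesis .
qed

lemma reverse_at_0 [simp]: "reverse_at d 0 = 0"
  by (simp add: poly_eq_iff coeff_reverse_at)

lemma reverse_at_add: "reverse_at d (p + r) = reverse_at d p + reverse_at d r"
  by (simp add: poly_eq_iff coeff_reverse_at)

lemma reverse_at_uminus: "reverse_at d (- p) = - reverse_at d p"
  by (simp add: poly_eq_iff coeff_reverse_at)

lemma reverse_at_diff: "reverse_at d (p - r) = reverse_at d p - reverse_at d r"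
  by (simp add: poly_eq_iff coeff_reverse_at)

lemma reverse_at_sum: "reverse_at d (\<Sum>x\<in>X. f x) = (\<Sum>x\<in>X. reverse_at d (f x))"
  by (induction X rule: infinite_finite_induct) (auto simp: reverse_at_add)

lemma reverse_at_sign: "reverse_at d ((- 1) ^ k * p) = (- 1) ^ k * reverse_at d p"
  by (cases "even k") (auto simp: reverse_at_uminus)

lemma reverse_at_Suc_q_mult: "reverse_at (Suc d) (q * p) = reverse_at d p"
  by (auto simp: poly_eq_iff coeff_reverse_at coeff_q_mult Suc_diff_le split: nat.splits)

lemma reverse_at_Suc:
  assumes "degree p \<le> d"
  shows "reverse_at (Suc d) p = q * reverse_at d p"
  using assms by (auto simp: poly_eq_iff coeff_reverse_at coeff_q_mult coeff_eq_0 split: nat.splits)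

lemma reverse_at_eq_reflect_poly:
  assumes "degree p \<le> d"
  shows "reverse_at d p = q ^ (d - degree p) * reflect_poly p"
  using assms
  by (auto simp: poly_eq_iff coeff_reverse_at coeff_power_q_mult coeff_reflect_poly coeff_eq_0
      intro!: arg_cong [where f = "coeff p"])

lemma reverse_at_mult:
  assumes "degree p \<le> a" "degree r \<le> b"
  shows "reverse_at (a + b) (p * r) = reverse_at a p * reverse_at b r"
proof (cases "p = 0 \<or> r = 0")
  case False
  then have deg: "degree (p * r) = degree p + degree r"
    by (simp add: degree_mult_eq)
  have "a + b - degree (p * r) = (a - degree p) + (b - degree r)"
    using assms deg by linarith
  then show ?thesis
    using assms deg
    by (simp add: reverse_at_eq_reflect_poly reflect_poly_mult flip: power_add)
qed auto

text \<open>Cancelling \<open>q ^ k\<close> lowers the reversal degree by the same amount. This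
  turns an identity multiplied by \<open>q ^ len u\<close> back into the Kazhdan--Lusztig form with
  \<open>l - len u\<close>.\<close>

lemma reverse_at_shift:
  assumes "reverse_at l p = q ^ k * r" "k \<le> l"
  shows "reverse_at (l - k) p = r"
proof (rule poly_eqI)
  fix i
  have "coeff r i = coeff (q ^ k * r) (i + k)"
    by (simp add: coeff_power_q_mult)
  also have "\<dots> = coeff (reverse_at l p) (i + k)"
    by (simp add: assms)
  also have "\<dots> = coeff (reverse_at (l - k) p) i"
    using assms(2) by (auto simp: coeff_reverse_at intro!: arg_cong [where f = "coeff p"])
  finally show "coeff (reverse_at (l - k) p) i = coeff r i" ..
qed

text \<open>The coefficients below degree \<open>k\<close> of the reversal are those of
  \<open>p\<close> in degrees \<open>l\<close>, \<open>l - 1\<close>, and so on; divisibility by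
  \<open>q ^ k\<close> makes them vanish. For a nonzero entry of a self-dual column this recovers
  \<open>degree (c z) + len z \<le> l\<close>.\<close>

lemma degree_le_if_reverse_at_eq:
  assumes "reverse_at l p = q ^ k * r" "degree p \<le> l"
  shows "degree p + k \<le> l \<or> p = 0"
proof (rule ccontr)
  assume "\<not> (degree p + k \<le> l \<or> p = 0)"
  then have "p \<noteq> 0" "l - degree p < k"
    using assms(2) by auto
  then have "coeff (reverse_at l p) (l - degree p) = 0"
    by (simp add: assms coeff_power_q_mult)
  then show False
    using \<open>p \<noteq> 0\<close> assms(2) by (simp add: coeff_reverse_at)
qed

text \<open>The cutoff is d/2 rounded up, so exactly the degrees strictly below d/2 survive. With
  \<open>d = len v - len u\<close> this is the range allowed to a Kazhdan--Lusztig
  polynomial.\<close>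

definition low_part :: "nat \<Rightarrow> int poly \<Rightarrow> int poly" where
  "low_part d p = poly_cutoff ((d + 1) div 2) p"

lemma coeff_low_part: "coeff (low_part d p) i = (if 2 * i < d then coeff p i else 0)"
proof -
  have "i < (d + 1) div 2 \<longleftrightarrow> 2 * i < d" by presburger
  then show ?thesis by (simp add: low_part_def coeff_poly_cutoff)
qed

lemma degree_low_part:
  assumes "0 < d"
  shows "2 * degree (low_part d p) < d"
proof (cases "low_part d p = 0")
  case False
  then have "coeff (low_part d p) (degree (low_part d p)) \<noteq> 0" by simp
  then show ?thesis by (simp add: coeff_low_part split: if_splits)
qed (use assms in auto)

text \<open>Antisymmetry under i -> d - i kills a middle coefficient, which is its own negative, and
  makes the part of \<open>p\<close> above d/2 minus the reversal of the part below.\<close>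

lemma reverse_at_low_part:
  assumes "reverse_at d p = - p"
  shows "reverse_at d (- low_part d p) = p - low_part d p"
proof (rule poly_eqI)
  fix i
  have c: "coeff p j = (if j \<le> d then - coeff p (d - j) else 0)" for j
    using arg_cong [OF assms, of "\<lambda>r. - coeff r j"] by (auto simp: coeff_reverse_at split: if_splits)
  consider "i > d" | "i \<le> d" "2 * i = d" | "i \<le> d" "2 * i \<noteq> d" by linarith
  then show "coeff (reverse_at d (- low_part d p)) i = coeff (p - low_part d p) i"
  proof cases
    case 1
    then show ?thesis using c [of i] by (simp add: coeff_reverse_at coeff_low_part)
  next
    case 2
    then have "d - i = i" by simp
    then have "coeff p i = 0" using c [of i] 2 by simp
    then show ?thesis using 2 \<open>d - i = i\<close> by (simp add: coeff_reverse_at coeff_low_part)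
  next
    case 3
    then show ?thesis using c [of i] by (auto simp: coeff_reverse_at coeff_low_part)
  qed
qed

section \<open>Length and Bruhat order\<close>

lemma word_prod_Nil [simp]: "word_prod G [] = \<one>\<^bsub>G\<^esub>"
  by (simp add: word_prod_def)

lemma word_prod_Cons [simp]: "word_prod G (s # ws) = s \<otimes>\<^bsub>G\<^esub> word_prod G ws"
  by (simp add: word_prod_def)

text \<open>Finite Coxeter groups, axiomatised by the compatibility \<open>refl_lift\<close> of the length with
  reflections; the exchange property below is a consequence of it.\<close>

locale finite_coxeter_group = group G for G (structure) +
  fixes S
  assumes finite_carrier: "finite (carrier G)"
    and S_subset: "S \<subseteq> carrier G"
    and S_square: "s \<in> S \<Longrightarrow> s \<otimes> s = \<one>"
    and generated: "w \<in> carrier G \<Longrightarrow> \<exists>ws. set ws \<subseteq> S \<and> word_prod G ws = w"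
    and len_neq: "\<lbrakk>w \<in> carrier G; s \<in> S\<rbrakk> \<Longrightarrow> cox_length G S (w \<otimes> s) \<noteq> cox_length G S w"
    and refl_lift: "\<lbrakk>x \<in> carrier G; t \<in> reflections G S; s \<in> S; t \<noteq> s;
      cox_length G S x < cox_length G S (x \<otimes> t)\<rbrakk>
      \<Longrightarrow> cox_length G S (x \<otimes> s) < cox_length G S (x \<otimes> t \<otimes> s)"
begin

abbreviation len :: "'a \<Rightarrow> nat" where "len \<equiv> cox_length G S"
abbreviation le :: "'a \<Rightarrow> 'a \<Rightarrow> bool" where "le \<equiv> bruhat_le G S"
abbreviation step :: "'a \<Rightarrow> 'a \<Rightarrow> bool" where "step \<equiv> bruhat_step G S"

lemma S_carrier [simp, intro]: "s \<in> S \<Longrightarrow> s \<in> carrier G"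
  using S_subset by auto

lemma S_inv [simp]: "s \<in> S \<Longrightarrow> inv s = s"
  using S_square inv_equality by auto

lemma mult_S_cancel [simp]: "\<lbrakk>w \<in> carrier G; s \<in> S\<rbrakk> \<Longrightarrow> w \<otimes> s \<otimes> s = w"
  by (simp add: m_assoc S_square)

lemma S_mult_cancel [simp]: "\<lbrakk>w \<in> carrier G; s \<in> S\<rbrakk> \<Longrightarrow> s \<otimes> (s \<otimes> w) = w"
  by (simp add: S_square flip: m_assoc)

lemma word_prod_closed [simp]: "set ws \<subseteq> S \<Longrightarrow> word_prod G ws \<in> carrier G"
  by (induction ws) auto

lemma word_prod_append:
  "\<lbrakk>set us \<subseteq> S; set ws \<subseteq> S\<rbrakk> \<Longrightarrow> word_prod G (us @ ws) = word_prod G us \<otimes> word_prod G ws"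
  by (induction us) (auto simp: m_assoc)

lemma word_prod_rev: "set ws \<subseteq> S \<Longrightarrow> word_prod G (rev ws) = inv (word_prod G ws)"
  by (induction ws) (auto simp: word_prod_append inv_mult_group)

lemma len_word_prod_le: "set ws \<subseteq> S \<Longrightarrow> len (word_prod G ws) \<le> length ws"
  unfolding cox_length_def by (rule Least_le) auto

lemma reduced_expression_exists:
  assumes "w \<in> carrier G"
  obtains ws where "reduced_expression G S ws w"
proof -
  have "\<exists>k ws. set ws \<subseteq> S \<and> length ws = k \<and> word_prod G ws = w"
    using generated [OF assms] by blast
  from LeastI_ex [OF this] show ?thesis
    using that unfolding reduced_expression_def cox_length_def by blast
qed

lemma len_one [simp]: "len \<one> = 0"
  using len_word_prod_le [of "[]"] by simp

lemma len_mult_le: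
  assumes "w \<in> carrier G" "s \<in> S"
  shows "len (w \<otimes> s) \<le> Suc (len w)"
proof -
  obtain ws where "reduced_expression G S ws w"
    using reduced_expression_exists assms by blast
  then show ?thesis
    using len_word_prod_le [of "ws @ [s]"] assms
    by (simp add: reduced_expression_def word_prod_append)
qed

lemma len_mult_cases:
  assumes "w \<in> carrier G" "s \<in> S"
  shows "len (w \<otimes> s) = Suc (len w) \<or> len w = Suc (len (w \<otimes> s))"
  using len_mult_le [OF assms] len_mult_le [of "w \<otimes> s" s] len_neq [OF assms] assms
  by auto

lemma len_mult_less_iff: "\<lbrakk>w \<in> carrier G; s \<in> S\<rbrakk> \<Longrightarrow> len (w \<otimes> s) < len w \<longleftrightarrow> \<not> len w < len (w \<otimes> s)"
  using len_mult_cases by fastforce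

lemma len_inv [simp]:
  assumes "w \<in> carrier G"
  shows "len (inv w) = len w"
proof -
  have *: "len (inv w) \<le> len w" if "w \<in> carrier G" for w
  proof -
    obtain ws where ws: "set ws \<subseteq> S" "word_prod G ws = w" "length ws = len w"
      using reduced_expression_exists \<open>w \<in> carrier G\<close>
      unfolding reduced_expression_def by metis
    then have "inv w = word_prod G (rev ws)"
      using word_prod_rev by metis
    then show ?thesis
      using len_word_prod_le [of "rev ws"] ws by simp
  qed
  show ?thesis
    using * [OF assms] * [OF inv_closed [OF assms]] assms by simp
qed

lemma len_left: "\<lbrakk>w \<in> carrier G; s \<in> S\<rbrakk> \<Longrightarrow> len (s \<otimes> w) = len (inv w \<otimes> s)"
  by (metis S_carrier S_inv inv_mult_group len_inv m_closed)

lemma len_left_cases: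
  "\<lbrakk>w \<in> carrier G; s \<in> S\<rbrakk> \<Longrightarrow> len (s \<otimes> w) = Suc (len w) \<or> len w = Suc (len (s \<otimes> w))"
  using len_mult_cases [of "inv w" s] by (simp add: len_left)

lemma descent_exists:
  assumes "w \<in> carrier G" "w \<noteq> \<one>"
  obtains s where "s \<in> S" "len w = Suc (len (w \<otimes> s))"
proof -
  obtain ws where ws: "reduced_expression G S ws w"
    using reduced_expression_exists assms by blast
  then have "ws \<noteq> []" using assms by (auto simp: reduced_expression_def)
  then obtain us s where us: "ws = us @ [s]" by (metis rev_exhaust)
  then have s: "s \<in> S" "set us \<subseteq> S" and w: "w = word_prod G us \<otimes> s" "len w = Suc (length us)"
    using ws by (auto simp: reduced_expression_def word_prod_append)
  then have "len (w \<otimes> s) < len w"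
    using len_word_prod_le [of us] by simp
  then show ?thesis
    using that [of s] len_mult_cases [of w s] assms s by auto
qed

lemma len_induct [consumes 1, case_names one mult]:
  assumes "w \<in> carrier G" and "P \<one>"
    and "\<And>w s. \<lbrakk>w \<in> carrier G; s \<in> S; len (w \<otimes> s) = Suc (len w); P w\<rbrakk> \<Longrightarrow> P (w \<otimes> s)"
  shows "P w"
  using assms(1)
proof (induction "len w" arbitrary: w rule: less_induct)
  case less
  show ?case
  proof (cases "w = \<one>")
    case False
    then obtain s where s: "s \<in> S" "len w = Suc (len (w \<otimes> s))"
      using descent_exists less.prems by blast
    then have "P (w \<otimes> s \<otimes> s)"
      using less.hyps [of "w \<otimes> s"] less.prems by (intro assms(3) [of "w \<otimes> s" s]) auto
    then show ?thesis using s less.prems by simp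
  qed (use assms in simp)
qed

lemma reflectionsI: "\<lbrakk>w \<in> carrier G; s \<in> S\<rbrakk> \<Longrightarrow> w \<otimes> s \<otimes> inv w \<in> reflections G S"
  by (auto simp: reflections_def)

lemma reflections_carrier [simp]: "t \<in> reflections G S \<Longrightarrow> t \<in> carrier G"
  by (auto simp: reflections_def)

lemma S_reflections: "s \<in> S \<Longrightarrow> s \<in> reflections G S"
  using reflectionsI [of \<one> s] by simp

lemma reflections_conj:
  assumes "t \<in> reflections G S" "x \<in> carrier G"
  shows "x \<otimes> t \<otimes> inv x \<in> reflections G S"
proof -
  obtain w s where t: "t = w \<otimes> s \<otimes> inv w" "w \<in> carrier G" "s \<in> S"
    using assms unfolding reflections_def by blast
  have "x \<otimes> t \<otimes> inv x = (x \<otimes> w) \<otimes> s \<otimes> inv (x \<otimes> w)"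
    using t(2,3) assms(2) unfolding t(1) by (simp add: inv_mult_group m_assoc)
  then show ?thesis
    using reflectionsI [of "x \<otimes> w" s] t(2,3) assms(2) by simp
qed

lemma reflections_inv:
  assumes "t \<in> reflections G S"
  shows "inv t = t"
proof -
  obtain w s where t: "t = w \<otimes> s \<otimes> inv w" "w \<in> carrier G" "s \<in> S"
    using assms unfolding reflections_def by blast
  show ?thesis
    using t(2,3) unfolding t(1) by (simp add: inv_mult_group m_assoc)
qed

text \<open>Write t u = u r with the reflection r = u^(-1) t u. If r differed from s,
  \<open>refl_lift\<close> would carry the ascent from u to u r over to an ascent from u s to t u s,
  against the last assumption.\<close>

lemma exchange:
  assumes "u \<in> carrier G" "s \<in> S" "t \<in> S" "len u < len (t \<otimes> u)"
    and "len (t \<otimes> u \<otimes> s) < len (u \<otimes> s)"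
  shows "t \<otimes> u = u \<otimes> s"
proof (rule ccontr)
  assume neq: "t \<otimes> u \<noteq> u \<otimes> s"
  let ?r = "inv u \<otimes> t \<otimes> u"
  have r: "?r \<in> reflections G S"
    using reflectionsI [of "inv u" t] assms by simp
  have ur: "u \<otimes> ?r = t \<otimes> u"
    using assms by (simp add: inv_solve_left' m_assoc) (simp flip: m_assoc)
  then have "?r \<noteq> s" using neq by auto
  then have "len (u \<otimes> s) < len (u \<otimes> ?r \<otimes> s)"
    using refl_lift [of u ?r s] assms r ur by simp
  then show False using assms ur by simp
qed

text \<open>By \<open>exchange\<close>, an ascent at s that is lost under left multiplication by t
  forces t to be a left descent, and then the lengths leave no room. This independence is what makes
  left and right Hecke multiplications commute in \<open>T_LT\<close>.\<close>

lemma descents_independent: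
  assumes u: "u \<in> carrier G" and st: "s \<in> S" "t \<in> S" and neq: "t \<otimes> u \<noteq> u \<otimes> s"
  shows "len (t \<otimes> u \<otimes> s) < len (t \<otimes> u) \<longleftrightarrow> len (u \<otimes> s) < len u"
    and "len (t \<otimes> u \<otimes> s) < len (u \<otimes> s) \<longleftrightarrow> len (t \<otimes> u) < len u"
proof -
  have up: "len (t \<otimes> v) < len (t \<otimes> v \<otimes> s)"
    if v: "v \<in> carrier G" "len v < len (v \<otimes> s)" "t \<otimes> v \<noteq> v \<otimes> s" for v
  proof (rule ccontr)
    assume "\<not> len (t \<otimes> v) < len (t \<otimes> v \<otimes> s)"
    then have l: "len (t \<otimes> v) = Suc (len (t \<otimes> v \<otimes> s))" "len (v \<otimes> s) = Suc (len v)"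
      using len_mult_cases [of "t \<otimes> v" s] len_mult_cases [of v s] v st by auto
    have "\<not> len v < len (t \<otimes> v)"
      using exchange [of v s t] v st l len_left_cases [of v t] by auto
    then have "len v = Suc (len (t \<otimes> v))"
      using len_left_cases [of v t] v st by auto
    \<comment> \<open>The lengths of v s and t v s would differ by three, although one generator
      separates them.\<close>
    then show False
      using l len_left_cases [of "v \<otimes> s" t] v st by (auto simp: m_assoc)
  qed
  have neq': "t \<otimes> (u \<otimes> s) \<noteq> u \<otimes> s \<otimes> s"
  proof
    assume "t \<otimes> (u \<otimes> s) = u \<otimes> s \<otimes> s"
    then have "t \<otimes> (t \<otimes> (u \<otimes> s)) = t \<otimes> u" using u st by simp
    then show False using neq u st by simp
  qed
  show a: "len (t \<otimes> u \<otimes> s) < len (t \<otimes> u) \<longleftrightarrow> len (u \<otimes> s) < len u"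
    using up [of u] up [of "u \<otimes> s"] u st neq neq' len_mult_cases [of u s]
    by (auto simp: m_assoc)
  show "len (t \<otimes> u \<otimes> s) < len (u \<otimes> s) \<longleftrightarrow> len (t \<otimes> u) < len u"
    using a u st len_mult_cases [of u s] len_mult_cases [of "t \<otimes> u" s]
      len_left_cases [of u t] len_left_cases [of "u \<otimes> s" t]
    by (auto simp: m_assoc)
qed

lemma stepI:
  "\<lbrakk>u \<in> carrier G; t \<in> reflections G S; len u < len (u \<otimes> t)\<rbrakk> \<Longrightarrow> step u (u \<otimes> t)"
  by (auto simp: bruhat_step_def)

lemma step_carrier: "step u v \<Longrightarrow> u \<in> carrier G" "step u v \<Longrightarrow> v \<in> carrier G"
  by (auto simp: bruhat_step_def)

lemma le_carrier: "le u v \<Longrightarrow> u \<in> carrier G" "le u v \<Longrightarrow> v \<in> carrier G"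
  by (auto simp: bruhat_le_def)

lemma le_refl [simp]: "u \<in> carrier G \<Longrightarrow> le u u"
  by (auto simp: bruhat_le_def)

lemma le_trans: "\<lbrakk>le u v; le v w\<rbrakk> \<Longrightarrow> le u w"
  by (auto simp: bruhat_le_def)

lemma step_imp_le: "step u v \<Longrightarrow> le u v"
  using step_carrier by (auto simp: bruhat_le_def)

lemma le_induct_left [consumes 1, case_names refl step]:
  assumes "le x y" and "P y" and "\<And>x z. \<lbrakk>step x z; le z y; P z\<rbrakk> \<Longrightarrow> P x"
  shows "P x"
proof -
  have "step\<^sup>*\<^sup>* x y" "y \<in> carrier G" using assms by (auto simp: bruhat_le_def)
  then have "le x y \<and> P x"
  proof (induction rule: converse_rtranclp_induct)
    case (step x z)
    then show ?case using assms(3) step_imp_le le_trans by blast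
  qed (use assms in auto)
  then show ?thesis ..
qed

lemma le_induct_right [consumes 1, case_names refl step]:
  assumes "le x y" and "P x" and "\<And>z y. \<lbrakk>le x z; step z y; P z\<rbrakk> \<Longrightarrow> P y"
  shows "P y"
proof -
  have "step\<^sup>*\<^sup>* x y" "x \<in> carrier G" using assms by (auto simp: bruhat_le_def)
  then have "le x y \<and> P y"
  proof (induction rule: rtranclp_induct)
    case (step z y)
    then show ?case using assms(3) step_imp_le le_trans by blast
  qed (use assms in auto)
  then show ?thesis ..
qed

lemma le_len: "le x y \<Longrightarrow> x = y \<or> len x < len y"
  by (induction rule: le_induct_left) (auto simp: bruhat_step_def)

lemma le_len': "le x y \<Longrightarrow> len x \<le> len y"
  using le_len by fastforce

lemma le_one_iff: "le x \<one> \<longleftrightarrow> x = \<one>"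
  using le_len [of x \<one>] by auto

text \<open>Since y s = x s (s t s), a conjugate reflection joins the two translates, and
  \<open>refl_lift\<close> supplies the length inequality unless t = s. The lifting properties of
  the Bruhat order rest on this.\<close>

lemma step_mult:
  assumes "step x y" "s \<in> S"
  shows "y = x \<otimes> s \<or> step (x \<otimes> s) (y \<otimes> s)"
proof -
  obtain t where t: "t \<in> reflections G S" "y = x \<otimes> t" "x \<in> carrier G" "len x < len y"
    using assms by (auto simp: bruhat_step_def)
  have "y \<otimes> s = x \<otimes> s \<otimes> (s \<otimes> t \<otimes> inv s)"
    using t assms by (simp add: m_assoc)
  then show ?thesis
    using refl_lift [of x t s] t assms stepI [of "x \<otimes> s" "s \<otimes> t \<otimes> inv s"]
      reflections_conj [of t s]
    by auto
qed

lemma le_mult_left_cases: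
  assumes "le x y" "s \<in> S"
  shows "le (x \<otimes> s) y \<or> le (x \<otimes> s) (y \<otimes> s)"
  using assms(1)
proof (induction rule: le_induct_left)
  case refl
  then show ?case using assms by (auto dest: le_carrier)
next
  case (step x z)
  then show ?case
    using step_mult [OF step(1) assms(2)] step_imp_le le_trans by blast
qed

lemma le_mult_right_cases:
  assumes "le x y" "s \<in> S"
  shows "le x (y \<otimes> s) \<or> le (x \<otimes> s) (y \<otimes> s)"
  using assms(1)
proof (induction rule: le_induct_right)
  case refl
  then show ?case using assms by (auto dest: le_carrier)
next
  case (step z y)
  then have "y = z \<otimes> s \<or> step (z \<otimes> s) (y \<otimes> s)" "z \<in> carrier G"
    using step_mult assms step_carrier by auto
  then show ?case
    using step assms step_imp_le le_trans by (metis mult_S_cancel)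
qed

lemma le_mult_up: "\<lbrakk>y \<in> carrier G; s \<in> S; len y < len (y \<otimes> s)\<rbrakk> \<Longrightarrow> le y (y \<otimes> s)"
  using stepI S_reflections step_imp_le by blast

text \<open>With this recursion lower intervals are computed one generator at a time, without
  subwords of reduced expressions.\<close>

lemma le_mult_iff:
  assumes "w \<in> carrier G" "s \<in> S" "len w < len (w \<otimes> s)" "x \<in> carrier G"
  shows "le x (w \<otimes> s) \<longleftrightarrow> le x w \<or> le (x \<otimes> s) w"
proof
  assume "le x (w \<otimes> s)"
  from le_mult_right_cases [OF this assms(2)] show "le x w \<or> le (x \<otimes> s) w"
    using assms by simp
next
  assume "le x w \<or> le (x \<otimes> s) w"
  then show "le x (w \<otimes> s)"
    using le_mult_up [of w s] le_mult_left_cases [of "x \<otimes> s" w s] assms le_trans by auto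
qed

lemma step_inv:
  assumes "step x y"
  shows "step (inv x) (inv y)"
proof -
  obtain t where t: "t \<in> reflections G S" "y = x \<otimes> t" "x \<in> carrier G" "len x < len y"
    using assms by (auto simp: bruhat_step_def)
  have "inv y = inv x \<otimes> (x \<otimes> t \<otimes> inv x)"
    using t by (simp add: inv_mult_group reflections_inv flip: m_assoc)
  then show ?thesis
    using t stepI [of "inv x" "x \<otimes> t \<otimes> inv x"] reflections_conj [of t x]
      step_carrier [OF assms] by (metis inv_closed len_inv)
qed

lemma le_inv:
  assumes "le x y"
  shows "le (inv x) (inv y)"
  using assms
proof (induction rule: le_induct_left)
  case refl
  then show ?case using le_carrier [OF assms] by simp
next
  case (step x z)
  then show ?case using step_inv step_imp_le le_trans by blast
qed

lemma le_inv_iff: "\<lbrakk>x \<in> carrier G; y \<in> carrier G\<rbrakk> \<Longrightarrow> le (inv x) (inv y) \<longleftrightarrow> le x y"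
  using le_inv [of x y] le_inv [of "inv x" "inv y"] by auto

end

section \<open>The Hecke algebra\<close>

context finite_coxeter_group
begin

text \<open>A function \<open>f\<close> supported on the group stands for the element of the Hecke algebra with
  coordinates \<open>f u\<close> in the standard basis. \<open>T s\<close> is right multiplication by the generator \<open>s\<close>,
  \<open>T_bar s\<close> is \<open>q\<close> times its inverse, \<open>flip\<close> is the anti-automorphism that inverts group elements.\<close>

definition supported :: "('a \<Rightarrow> int poly) \<Rightarrow> bool" where
  "supported f \<longleftrightarrow> (\<forall>u. u \<notin> carrier G \<longrightarrow> f u = 0)"

definition T :: "'a \<Rightarrow> ('a \<Rightarrow> int poly) \<Rightarrow> 'a \<Rightarrow> int poly" where
  "T s f u = (if u \<notin> carrier G then 0
     else if len (u \<otimes> s) < len u then f (u \<otimes> s) + (q - 1) * f u else q * f (u \<otimes> s))"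

definition T_bar :: "'a \<Rightarrow> ('a \<Rightarrow> int poly) \<Rightarrow> 'a \<Rightarrow> int poly" where
  "T_bar s f u = (if u \<notin> carrier G then 0
     else if len (u \<otimes> s) < len u then f (u \<otimes> s) else q * f (u \<otimes> s) - (q - 1) * f u)"

definition flip :: "('a \<Rightarrow> int poly) \<Rightarrow> 'a \<Rightarrow> int poly" where
  "flip f u = (if u \<notin> carrier G then 0 else f (inv u))"

definition delta :: "'a \<Rightarrow> 'a \<Rightarrow> int poly" where
  "delta w u = (if u = w then 1 else 0)"

lemma supported_T [simp]: "supported (T s f)"
  and supported_T_bar [simp]: "supported (T_bar s f)"
  and supported_flip [simp]: "supported (flip f)"
  by (simp_all add: supported_def T_def T_bar_def flip_def)

lemma supported_delta [simp]: "w \<in> carrier G \<Longrightarrow> supported (delta w)"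
  by (auto simp: supported_def delta_def)

lemma supported_eqI:
  "\<lbrakk>supported f; supported g; \<And>u. u \<in> carrier G \<Longrightarrow> f u = g u\<rbrakk> \<Longrightarrow> f = g"
  unfolding supported_def by (metis ext)

lemma flip_flip [simp]: "supported f \<Longrightarrow> flip (flip f) = f"
  by (rule supported_eqI) (auto simp: flip_def)

lemma flip_delta [simp]: "w \<in> carrier G \<Longrightarrow> flip (delta w) = delta (inv w)"
  by (rule supported_eqI) (auto simp: flip_def delta_def)

text \<open>The quadratic relation of the Hecke algebra, in the form q T_s^(-1) = T_s - (q -
  1).\<close>

lemma T_bar_eq: "supported f \<Longrightarrow> T_bar s f = (\<lambda>u. T s f u - (q - 1) * f u)"
  by (auto simp: T_bar_def T_def supported_def fun_eq_iff algebra_simps)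

lemma T_T_bar:
  assumes "s \<in> S" "supported f"
  shows "T s (T_bar s f) = (\<lambda>u. q * f u)"
proof
  fix u
  show "T s (T_bar s f) u = q * f u"
  proof (cases "u \<in> carrier G")
    case True
    then have "u \<otimes> s \<in> carrier G" "u \<otimes> s \<otimes> s = u" using assms(1) by simp_all
    moreover have "len (u \<otimes> s) < len u \<longleftrightarrow> \<not> len u < len (u \<otimes> s)"
      using True assms(1) by (rule len_mult_less_iff)
    ultimately show ?thesis
      using True by (simp add: T_def T_bar_def algebra_simps)
  next
    case False
    then show ?thesis using assms(2) by (simp add: T_def supported_def)
  qed
qed

lemma T_bar_T:
  assumes "s \<in> S" "supported f"
  shows "T_bar s (T s f) = (\<lambda>u. q * f u)"
proof
  fix u
  show "T_bar s (T s f) u = q * f u"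
  proof (cases "u \<in> carrier G")
    case True
    then have "u \<otimes> s \<in> carrier G" "u \<otimes> s \<otimes> s = u" using assms(1) by simp_all
    moreover have "len (u \<otimes> s) < len u \<longleftrightarrow> \<not> len u < len (u \<otimes> s)"
      using True assms(1) by (rule len_mult_less_iff)
    ultimately show ?thesis
      using True by (simp add: T_def T_bar_def algebra_simps)
  next
    case False
    then show ?thesis using assms(2) by (simp add: T_bar_def supported_def)
  qed
qed

lemma T_bar_T_bar:
  assumes "s \<in> S" "supported f"
  shows "T_bar s (T_bar s f) = (\<lambda>u. q * f u - (q - 1) * T_bar s f u)"
proof -
  have "T_bar s (T_bar s f) = (\<lambda>u. T s (T_bar s f) u - (q - 1) * T_bar s f u)"
    by (rule T_bar_eq) simp
  then show ?thesis using T_T_bar [OF assms] by simp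
qed

lemma T_delta_up:
  assumes "w \<in> carrier G" "s \<in> S" "len w < len (w \<otimes> s)"
  shows "T s (delta w) = delta (w \<otimes> s)"
proof (rule supported_eqI)
  fix u assume u: "u \<in> carrier G"
  have eq: "u \<otimes> s = w \<longleftrightarrow> u = w \<otimes> s"
    using u assms by (metis mult_S_cancel)
  show "T s (delta w) u = delta (w \<otimes> s) u"
    using u assms by (auto simp: T_def delta_def eq)
qed (use assms in auto)

lemma T_delta_down:
  assumes "w \<in> carrier G" "s \<in> S" "len (w \<otimes> s) < len w"
  shows "T s (delta w) = (\<lambda>u. q * delta (w \<otimes> s) u + (q - 1) * delta w u)"
proof (rule supported_eqI)
  fix u assume u: "u \<in> carrier G"
  have eq: "u \<otimes> s = w \<longleftrightarrow> u = w \<otimes> s"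
    using u assms by (metis mult_S_cancel)
  show "T s (delta w) u = q * delta (w \<otimes> s) u + (q - 1) * delta w u"
    using u assms len_neq [of w s] by (auto simp: T_def delta_def eq)
next
  show "supported (\<lambda>u. q * delta (w \<otimes> s) u + (q - 1) * delta w u)"
    using assms by (auto simp: supported_def delta_def)
qed (use assms in auto)

section \<open>Linear operators and the commutation of left and right multiplication\<close>

definition linear_op :: "(('a \<Rightarrow> int poly) \<Rightarrow> 'a \<Rightarrow> int poly) \<Rightarrow> bool" where
  "linear_op A \<longleftrightarrow> (\<forall>X c F. finite (X :: 'a set) \<longrightarrow>
     A (\<lambda>u. \<Sum>x\<in>X. c x * F x u) = (\<lambda>u. \<Sum>x\<in>X. c x * A (F x) u))"

lemma linear_op_sum:
  "\<lbrakk>linear_op A; finite X\<rbrakk> \<Longrightarrow> A (\<lambda>u. \<Sum>x\<in>X. c x * F x u) = (\<lambda>u. \<Sum>x\<in>X. c x * A (F x) u)"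
  for X :: "'a set"
  unfolding linear_op_def by blast

lemma linear_op_scale:
  assumes "linear_op A"
  shows "A (\<lambda>u. c * f u) = (\<lambda>u. c * A f u)"
  using linear_op_sum [OF assms, of "{undefined}" "\<lambda>_. c" "\<lambda>_. f"] by simp

lemma linear_op_comp:
  assumes "linear_op A" "linear_op B"
  shows "linear_op (\<lambda>f. A (B f))"
  unfolding linear_op_def using linear_op_sum [OF assms(1)] linear_op_sum [OF assms(2)] by simp

lemma linear_T: "linear_op (T s)"
  unfolding linear_op_def T_def
  by (auto simp: fun_eq_iff sum_distrib_left sum.distrib sum_subtractf algebra_simps)

lemma linear_T_bar: "linear_op (T_bar s)"
  unfolding linear_op_def T_bar_def
  by (auto simp: fun_eq_iff sum_distrib_left sum.distrib sum_subtractf algebra_simps)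

lemma linear_fold: "(\<And>s. linear_op (A s)) \<Longrightarrow> linear_op (fold A ws)"
  by (induction ws) (auto simp: linear_op_def)

lemma supported_expand:
  assumes "supported f"
  shows "f = (\<lambda>u. \<Sum>x\<in>carrier G. f x * delta x u)"
proof
  fix u
  have "(\<Sum>x\<in>carrier G. f x * delta x u) = (\<Sum>x\<in>carrier G. if x = u then f x else 0)"
    by (intro sum.cong) (auto simp: delta_def)
  also have "\<dots> = f u"
    using assms finite_carrier by (auto simp: supported_def)
  finally show "f u = (\<Sum>x\<in>carrier G. f x * delta x u)" ..
qed

lemma linear_op_eqI:
  assumes "linear_op A" "linear_op B" "supported f"
    and "\<And>x. x \<in> carrier G \<Longrightarrow> A (delta x) = B (delta x)"
  shows "A f = B f"
proof -
  have "A (\<lambda>u. \<Sum>x\<in>carrier G. f x * delta x u) = B (\<lambda>u. \<Sum>x\<in>carrier G. f x * delta x u)"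
    using assms by (simp add: linear_op_sum finite_carrier)
  then show ?thesis using supported_expand [OF assms(3)] by simp
qed

text \<open>Conjugation by the anti-automorphism makes this left multiplication by the generator
  \<open>t\<close>; \<open>LT_eq\<close> gives its coordinates.\<close>

definition LT :: "'a \<Rightarrow> ('a \<Rightarrow> int poly) \<Rightarrow> 'a \<Rightarrow> int poly" where
  "LT t f = flip (T t (flip f))"

lemma supported_LT [simp]: "supported (LT s f)"
  by (simp add: LT_def)

lemma LT_eq:
  assumes "t \<in> S" "u \<in> carrier G"
  shows "LT t f u =
    (if len (t \<otimes> u) < len u then f (t \<otimes> u) + (q - 1) * f u else q * f (t \<otimes> u))"
  using assms by (simp add: LT_def flip_def T_def inv_mult_group len_left)

text \<open>If t u = u s, both operators act in the same way on the pair u, u s. Otherwise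
  \<open>descents_independent\<close> shows that the two descent conditions do not interact, so the
  four-term expansions agree.\<close>

lemma T_LT:
  assumes st: "s \<in> S" "t \<in> S"
  shows "T s (LT t f) = LT t (T s f)"
proof (rule supported_eqI)
  fix u assume u: "u \<in> carrier G"
  show "T s (LT t f) u = LT t (T s f) u"
  proof (cases "t \<otimes> u = u \<otimes> s")
    case True
    then have "t \<otimes> (u \<otimes> s) = u" "u \<otimes> s \<otimes> s = u" "t \<otimes> u \<otimes> s = u" "len (t \<otimes> u) = len (u \<otimes> s)"
      using u st by (metis S_mult_cancel, simp_all)
    then show ?thesis
      using u st True by (auto simp: T_def LT_eq)
  next
    case False
    have a: "t \<otimes> (u \<otimes> s) = t \<otimes> u \<otimes> s"
      using u st by (simp add: m_assoc)
    show ?thesis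
      using u st descents_independent [OF u st False]
      by (simp add: T_def LT_eq a algebra_simps)
  qed
qed simp_all

lemma fold_T_LT:
  assumes "set ws \<subseteq> S" "t \<in> S"
  shows "fold T ws (LT t f) = LT t (fold T ws f)"
  using assms(1)
proof (induction ws arbitrary: f)
  case (Cons s ws)
  then show ?case using T_LT [of s t f] assms(2) by simp
qed simp

lemma fold_T_fold_LT:
  "\<lbrakk>set us \<subseteq> S; set ws \<subseteq> S\<rbrakk> \<Longrightarrow> fold T us (fold LT ws f) = fold LT ws (fold T us f)"
  by (induction ws arbitrary: f) (simp_all add: fold_T_LT)

lemma supported_fold:
  "\<lbrakk>\<And>s f. supported (A s f); supported f\<rbrakk> \<Longrightarrow> supported (fold A ws f)"
  by (induction ws arbitrary: f) auto

lemma fold_LT_eq: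
  assumes "supported f"
  shows "fold LT ws f = flip (fold T ws (flip f))"
  using assms
proof (induction ws arbitrary: f)
  case (Cons s ws)
  then show ?case using Cons.IH [of "LT s f"] by (simp add: LT_def)
qed simp

lemma reduced_snoc:
  assumes "reduced_expression G S (ws @ [s]) w"
  shows "reduced_expression G S ws (w \<otimes> s)" "s \<in> S" "w \<in> carrier G" "len w = Suc (len (w \<otimes> s))"
proof -
  have s: "s \<in> S" "set ws \<subseteq> S" and w: "w = word_prod G ws \<otimes> s" "len w = Suc (length ws)"
    using assms by (auto simp: reduced_expression_def word_prod_append)
  then have ws: "w \<otimes> s = word_prod G ws" "w \<in> carrier G" by auto
  have "len (w \<otimes> s) \<le> length ws"
    using len_word_prod_le [of ws] s ws by simp
  then have "len w = Suc (len (w \<otimes> s))"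
    using len_mult_cases [of w s] s w ws by linarith
  then show "reduced_expression G S ws (w \<otimes> s)" "s \<in> S" "w \<in> carrier G"
      "len w = Suc (len (w \<otimes> s))"
    using s w ws by (auto simp: reduced_expression_def)
qed

lemma fold_T_delta_one:
  "reduced_expression G S ws w \<Longrightarrow> fold T ws (delta \<one>) = delta w"
proof (induction ws arbitrary: w rule: rev_induct)
  case Nil
  then show ?case by (auto simp: reduced_expression_def)
next
  case (snoc s ws)
  note r = reduced_snoc [OF snoc.prems]
  then have "fold T (ws @ [s]) (delta \<one>) = T s (delta (w \<otimes> s))"
    using snoc.IH by simp
  also have "\<dots> = delta w"
    using T_delta_up [of "w \<otimes> s" s] r by simp
  finally show ?case .
qed

text \<open>Since left and right multiplications commute, the operator of right multiplication along a
  word is determined by its value at the unit element.\<close>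

lemma fold_T_cong:
  assumes "reduced_expression G S us w" "reduced_expression G S ws w" "supported f"
  shows "fold T us f = fold T ws f"
proof (rule linear_op_eqI [OF _ _ assms(3)])
  fix x assume x: "x \<in> carrier G"
  then obtain vs where vs: "reduced_expression G S vs (inv x)"
    using reduced_expression_exists inv_closed by blast
  have set: "set us \<subseteq> S" "set ws \<subseteq> S" "set vs \<subseteq> S"
    using assms vs by (auto simp: reduced_expression_def)
  have "fold LT vs (delta \<one>) = delta x"
    using fold_T_delta_one [OF vs] x by (simp add: fold_LT_eq)
  then show "fold T us (delta x) = fold T ws (delta x)"
    using fold_T_fold_LT [OF set(1,3), of "delta \<one>"] fold_T_fold_LT [OF set(2,3), of "delta \<one>"]
      fold_T_delta_one [OF assms(1)] fold_T_delta_one [OF assms(2)] by simp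
qed (intro linear_fold linear_T)+

lemma fold_T_rev_fold_T_bar:
  "\<lbrakk>set ws \<subseteq> S; supported f\<rbrakk>
   \<Longrightarrow> fold T (rev ws) (fold T_bar ws f) = (\<lambda>u. q ^ length ws * f u)"
proof (induction ws arbitrary: f)
  case (Cons s ws)
  have "fold T (rev (s # ws)) (fold T_bar (s # ws) f)
      = T s (fold T (rev ws) (fold T_bar ws (T_bar s f)))"
    by simp
  also have "\<dots> = T s (\<lambda>u. q ^ length ws * T_bar s f u)"
    using Cons.IH [of "T_bar s f"] Cons.prems by simp
  also have "\<dots> = (\<lambda>u. q ^ length ws * T s (T_bar s f) u)"
    by (rule linear_op_scale [OF linear_T])
  also have "\<dots> = (\<lambda>u. q ^ length (s # ws) * f u)"
    using T_T_bar [of s f] Cons.prems by (simp add: mult_ac)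
  finally show ?case .
qed simp

lemma fold_T_bar_fold_T_rev:
  "\<lbrakk>set ws \<subseteq> S; supported f\<rbrakk>
   \<Longrightarrow> fold T_bar ws (fold T (rev ws) f) = (\<lambda>u. q ^ length ws * f u)"
proof (induction ws arbitrary: f)
  case (Cons s ws)
  let ?g = "fold T (rev ws) f"
  have g: "supported ?g"
    using Cons.prems by (intro supported_fold) auto
  have "fold T_bar (s # ws) (fold T (rev (s # ws)) f) = fold T_bar ws (T_bar s (T s ?g))"
    by simp
  also have "\<dots> = fold T_bar ws (\<lambda>u. q * ?g u)"
    using T_bar_T [of s ?g] g Cons.prems by simp
  also have "\<dots> = (\<lambda>u. q * fold T_bar ws ?g u)"
    by (rule linear_op_scale [OF linear_fold [OF linear_T_bar]])
  also have "\<dots> = (\<lambda>u. q ^ length (s # ws) * f u)"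
    using Cons by (simp add: mult_ac)
  finally show ?case .
qed simp

lemma reduced_rev:
  "\<lbrakk>reduced_expression G S ws w; w \<in> carrier G\<rbrakk> \<Longrightarrow> reduced_expression G S (rev ws) (inv w)"
  by (auto simp: reduced_expression_def word_prod_rev)

text \<open>Up to the factor \<open>q ^ length ws\<close>, the \<open>T_bar\<close> operator of a
  word inverts the \<open>T\<close> operator of the reversed word, and \<open>fold_T_cong\<close>
  makes the latter independent of the word. The power of q then cancels.\<close>

lemma fold_T_bar_cong:
  assumes us: "reduced_expression G S us w" and ws: "reduced_expression G S ws w"
    and f: "supported f"
  shows "fold T_bar us f = fold T_bar ws f"
proof -
  have set: "set us \<subseteq> S" "set ws \<subseteq> S" and len: "length us = length ws" and w: "w \<in> carrier G"
    using us ws by (auto simp: reduced_expression_def)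
  let ?g = "fold T_bar us f"
  have g: "supported ?g" using f by (intro supported_fold) auto
  have "(\<lambda>u. q ^ length ws * ?g u) = fold T_bar ws (fold T (rev ws) ?g)"
    using fold_T_bar_fold_T_rev [OF set(2) g] by simp
  also have "fold T (rev ws) ?g = fold T (rev us) ?g"
    using fold_T_cong [OF reduced_rev [OF ws w] reduced_rev [OF us w] g] .
  also have "\<dots> = (\<lambda>u. q ^ length ws * f u)"
    using fold_T_rev_fold_T_bar [OF set(1) f] len by simp
  also have "fold T_bar ws \<dots> = (\<lambda>u. q ^ length ws * fold T_bar ws f u)"
    by (rule linear_op_scale [OF linear_fold [OF linear_T_bar]])
  finally show ?thesis by (simp add: fun_eq_iff)
qed

text \<open>\<open>N w\<close> lists the coordinates of \<open>q ^ len w\<close> times the inverse of the basis element of \<open>inv w\<close>;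
  up to sign these are the \<open>R\<close>-polynomials \<open>R u w\<close>.\<close>

definition N :: "'a \<Rightarrow> 'a \<Rightarrow> int poly" where
  "N w = fold T_bar (SOME ws. reduced_expression G S ws w) (delta \<one>)"

lemma N_eq:
  assumes "reduced_expression G S ws w"
  shows "N w = fold T_bar ws (delta \<one>)"
  unfolding N_def by (rule fold_T_bar_cong [OF someI assms]) (use assms in auto)

lemma N_one: "N \<one> = delta \<one>"
  using N_eq [of "[]" \<one>] by (simp add: reduced_expression_def)

lemma supported_N [simp]: "w \<in> carrier G \<Longrightarrow> supported (N w)"
  using reduced_expression_exists N_eq supported_fold
  by (metis supported_T_bar supported_delta one_closed)

lemma N_mult:
  assumes "w \<in> carrier G" "s \<in> S" "len w < len (w \<otimes> s)"
  shows "N (w \<otimes> s) = T_bar s (N w)"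
proof -
  obtain ws where ws: "reduced_expression G S ws w"
    using reduced_expression_exists assms by blast
  then have "reduced_expression G S (ws @ [s]) (w \<otimes> s)"
    using assms len_mult_cases [of w s] by (auto simp: reduced_expression_def word_prod_append)
  then show ?thesis using N_eq ws by simp
qed

lemma N_mult_down:
  assumes "w \<in> carrier G" "s \<in> S" "len (w \<otimes> s) < len w"
  shows "T_bar s (N w) = (\<lambda>u. q * N (w \<otimes> s) u - (q - 1) * N w u)"
  using N_mult [of "w \<otimes> s" s] T_bar_T_bar [of s "N (w \<otimes> s)"] assms by simp

lemma T_bar_LT:
  assumes "s \<in> S" "t \<in> S" "supported f"
  shows "T_bar s (LT t f) = LT t (T_bar s f)"
proof (rule supported_eqI)
  fix u assume "u \<in> carrier G"
  then show "T_bar s (LT t f) u = LT t (T_bar s f) u"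
    using T_LT [OF assms(1,2), of f] assms
    by (auto simp: T_bar_eq LT_eq algebra_simps)
qed simp_all

lemma T_bar_flip_T_bar:
  assumes "s \<in> S" "t \<in> S" "supported f"
  shows "T_bar s (flip (T_bar t (flip f))) = flip (T_bar t (flip (T_bar s f)))"
proof -
  have *: "flip (T_bar t (flip g)) = (\<lambda>u. LT t g u - (q - 1) * g u)" if "supported g" for g
    using that T_bar_eq [of "flip g" t]
    by (auto simp: LT_def flip_def fun_eq_iff supported_def)
  have "T_bar s (\<lambda>u. LT t f u - (q - 1) * f u)
      = (\<lambda>u. T_bar s (LT t f) u - (q - 1) * T_bar s f u)"
    by (simp add: T_bar_def fun_eq_iff algebra_simps)
  also have "\<dots> = (\<lambda>u. LT t (T_bar s f) u - (q - 1) * T_bar s f u)"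
    using T_bar_LT [OF assms] by simp
  finally show ?thesis
    using * [OF assms(3)] * [of "T_bar s f"] by simp
qed

lemma T_bar_delta_one:
  assumes "t \<in> S"
  shows "flip (T_bar t (delta \<one>)) = T_bar t (delta \<one>)"
proof (rule supported_eqI)
  fix u assume u: "u \<in> carrier G"
  have *: "v \<otimes> t = \<one> \<longleftrightarrow> v = t" if "v \<in> carrier G" for v
    using that assms by (metis S_carrier S_square S_inv inv_equality inv_inv)
  have **: "inv u = t \<longleftrightarrow> u = t" "inv u = \<one> \<longleftrightarrow> u = \<one>"
    using u assms by (metis S_carrier S_inv inv_inv, metis inv_inv inv_one)
  have "len (\<one> \<otimes> t) \<noteq> len \<one>" "len (t \<otimes> t) < len t"
    using len_neq [of \<one> t] assms by (auto simp: S_square)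
  then show "flip (T_bar t (delta \<one>)) u = T_bar t (delta \<one>) u"
    using u assms by (auto simp: flip_def T_bar_def delta_def * ** S_square)
qed simp_all

text \<open>A word for w read backwards is a word for its inverse, whereas \<open>N\<close> grows by
  letters appended on the right. On the unit the first letter acts alike from either side; as a left
  multiplication it commutes with the remaining letters and can be applied last.\<close>

lemma flip_N:
  assumes "w \<in> carrier G"
  shows "flip (N w) = N (inv w)"
proof -
  have fold_swap: "fold T_bar ws (flip (T_bar t (flip f))) = flip (T_bar t (flip (fold T_bar ws f)))"
    if "set ws \<subseteq> S" "t \<in> S" "supported f" for ws t f
    using that
  proof (induction ws arbitrary: f)
    case (Cons s ws)
    then show ?case using T_bar_flip_T_bar [of s t f] by simp
  qed simp
  have "flip (fold T_bar ws (delta \<one>)) = N (inv w)" if "reduced_expression G S ws w" for ws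
    using that
  proof (induction ws arbitrary: w)
    case Nil
    then show ?case by (auto simp: reduced_expression_def N_one)
  next
    case (Cons t ws)
    then have "reduced_expression G S (rev (t # ws)) (inv w)"
      by (intro reduced_rev) (auto simp: reduced_expression_def)
    then have r: "reduced_expression G S (rev ws) (inv w \<otimes> t)" "t \<in> S" "inv w \<in> carrier G"
      "len (inv w) = Suc (len (inv w \<otimes> t))"
      using reduced_snoc [of "rev ws" t "inv w"] by auto
    have ws: "set ws \<subseteq> S" and w: "w \<in> carrier G"
      using Cons.prems by (auto simp: reduced_expression_def)
    have "reduced_expression G S ws (inv (inv w \<otimes> t))"
      using reduced_rev [OF r(1)] r by simp
    from Cons.IH [OF this] have IH: "flip (fold T_bar ws (delta \<one>)) = N (inv w \<otimes> t)"
      using r by simp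
    have "fold T_bar (t # ws) (delta \<one>) = fold T_bar ws (flip (T_bar t (flip (delta \<one>))))"
      using T_bar_delta_one r by simp
    also have "\<dots> = flip (T_bar t (flip (fold T_bar ws (delta \<one>))))"
      by (rule fold_swap) (use ws r in auto)
    finally have "flip (fold T_bar (t # ws) (delta \<one>)) = T_bar t (N (inv w \<otimes> t))"
      using IH by simp
    also have "\<dots> = N (inv w)"
      using N_mult [of "inv w \<otimes> t" t] r by simp
    finally show ?case .
  qed
  then show ?thesis
    using reduced_expression_exists [OF assms] N_eq by metis
qed

end

section \<open>R-polynomials and the bar involution\<close>

lemma degree_T_le:
  assumes "degree a \<le> d" "degree b \<le> d"
  shows "degree (a + q * b) \<le> Suc d" "degree (q * a - (q - 1) * b) \<le> Suc d"
proof -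
  have *: "degree (q * a) \<le> Suc d" "degree (q * b) \<le> Suc d" "degree a \<le> Suc d" "degree b \<le> Suc d"
    using assms degree_q_mult_le by auto
  show "degree (a + q * b) \<le> Suc d"
    using * by (intro degree_add_le)
  have "q * a - (q - 1) * b = q * a - (q * b - b)"
    by (simp add: algebra_simps)
  then show "degree (q * a - (q - 1) * b) \<le> Suc d"
    using * by (simp only:) (intro degree_diff_le)
qed

context finite_coxeter_group
begin

lemma N_mult_apply:
  assumes "w \<in> carrier G" "s \<in> S" "len w < len (w \<otimes> s)" "u \<in> carrier G"
  shows "N (w \<otimes> s) u =
    (if len (u \<otimes> s) < len u then N w (u \<otimes> s) else q * N w (u \<otimes> s) - (q - 1) * N w u)"
  using assms by (simp add: N_mult T_bar_def)

lemma N_nonzero_imp_le: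
  assumes "w \<in> carrier G" "N w u \<noteq> 0"
  shows "le u w"
  using assms
proof (induction arbitrary: u rule: len_induct)
  case one
  then show ?case by (simp add: N_one delta_def split: if_splits)
next
  case (mult w s)
  then have up: "len w < len (w \<otimes> s)" by simp
  have u: "u \<in> carrier G"
    using mult.prems supported_N [of "w \<otimes> s"] mult.hyps unfolding supported_def by auto
  have "N w (u \<otimes> s) \<noteq> 0 \<or> N w u \<noteq> 0"
    using mult.prems N_mult_apply [OF mult.hyps(1,2) up u] by (auto split: if_splits)
  then show ?case
    using mult.IH le_mult_iff [OF mult.hyps(1,2) up u] by blast
qed

lemma N_diag: "w \<in> carrier G \<Longrightarrow> N w w = 1"
proof (induction rule: len_induct)
  case one
  then show ?case by (simp add: N_one delta_def)
next
  case (mult w s)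
  then show ?case using N_mult_apply [of w s "w \<otimes> s"] by simp
qed

text \<open>The known symmetry q^d R(1/q) = (-1)^d R with d = l(w) - l(u), proved along the
  recursion of \<open>T_bar\<close>. The factor \<open>q ^ len u\<close> avoids the subtraction, so
  the identity also covers u longer than w, where \<open>N w u\<close> is 0.\<close>

lemma reverse_at_N:
  assumes "w \<in> carrier G" "u \<in> carrier G"
  shows "degree (N w u) \<le> len w \<and>
    reverse_at (len w) (N w u) = (- 1) ^ (len w + len u) * q ^ len u * N w u"
  using assms
proof (induction arbitrary: u rule: len_induct)
  case one
  have "reverse_at 0 1 = 1"
    by (simp add: poly_eq_iff coeff_reverse_at)
  then show ?case by (simp add: N_one delta_def)
next
  case (mult w s)
  then have up: "len w < len (w \<otimes> s)" by simp
  let ?a = "N w (u \<otimes> s)" and ?b = "N w u" and ?l = "len w"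
  note us = mult.IH [of u] mult.IH [of "u \<otimes> s"]
  have deg: "degree ?a \<le> ?l" "degree ?b \<le> ?l"
    using us mult by auto
  have rev: "reverse_at ?l ?b = (- 1) ^ (?l + len u) * q ^ len u * ?b"
    "reverse_at ?l ?a = (- 1) ^ (?l + len (u \<otimes> s)) * q ^ len (u \<otimes> s) * ?a"
    using us mult by auto
  consider "len u = Suc (len (u \<otimes> s))" | "len (u \<otimes> s) = Suc (len u)"
    using len_mult_cases mult by blast
  then show ?case
  proof cases
    case 1
    then have "N (w \<otimes> s) u = ?a"
      using N_mult_apply [OF mult.hyps(1,2) up mult.prems] by simp
    then show ?thesis
      using deg rev 1 mult.hyps by (simp add: reverse_at_Suc algebra_simps)
  next
    case 2
    then have N: "N (w \<otimes> s) u = q * ?a - (q - 1) * ?b"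
      using N_mult_apply [OF mult.hyps(1,2) up mult.prems] by simp
    also have "reverse_at (Suc ?l) \<dots> = reverse_at (Suc ?l) (q * ?a - q * ?b + ?b)"
      by (simp add: algebra_simps)
    also have "\<dots> = reverse_at ?l ?a - reverse_at ?l ?b + q * reverse_at ?l ?b"
      using deg by (simp add: reverse_at_add reverse_at_diff reverse_at_Suc reverse_at_Suc_q_mult)
    also have "\<dots> = (- 1) ^ (Suc ?l + len u) * q ^ len u * (q * ?a - (q - 1) * ?b)"
      unfolding rev 2 by (simp add: algebra_simps)
    finally show ?thesis
      using N degree_T_le(2) [OF deg] mult.hyps by simp
  qed
qed

definition R :: "'a \<Rightarrow> 'a \<Rightarrow> int poly" where
  "R u v = (if v \<in> carrier G then (- 1) ^ (len u + len v) * N v u else 0)"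

lemma R_family_R: "R_family G S R"
  unfolding R_family_def
proof (intro conjI allI ballI impI)
  fix u v assume "\<not> le u v"
  then show "R u v = 0" using N_nonzero_imp_le by (auto simp: R_def)
next
  fix u assume "u \<in> carrier G"
  then show "R u u = 1" by (simp add: R_def N_diag)
next
  fix u v s assume u: "u \<in> carrier G" and v: "v \<in> carrier G" and s: "s \<in> right_descents G S v"
  have sS: "s \<in> S" "len (v \<otimes> s) < len v"
    using s by (auto simp: right_descents_def)
  then have l: "len v = Suc (len (v \<otimes> s))"
    using len_mult_cases v by fastforce
  have N: "N v u = (if len (u \<otimes> s) < len u then N (v \<otimes> s) (u \<otimes> s)
      else q * N (v \<otimes> s) (u \<otimes> s) - (q - 1) * N (v \<otimes> s) u)"
    using N_mult_apply [of "v \<otimes> s" s u] u v sS by simp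
  have qs: "[:0, 1:] = q" "[:-1, 1:] = q - 1"
    by (simp_all add: q_def one_pCons)
  show "R u v = (if s \<in> right_descents G S u then R (u \<otimes> s) (v \<otimes> s)
      else [:0, 1:] * R (u \<otimes> s) (v \<otimes> s) + [:- 1, 1:] * R u (v \<otimes> s))"
  proof (cases "len (u \<otimes> s) < len u")
    case True
    then have "len u = Suc (len (u \<otimes> s))"
      using len_mult_cases [of u s] u sS by auto
    then show ?thesis
      using True v sS N l by (simp add: R_def right_descents_def)
  next
    case False
    then have "len (u \<otimes> s) = Suc (len u)"
      using len_mult_cases [of u s] u sS by auto
    moreover from False have "N v u = q * N (v \<otimes> s) (u \<otimes> s) - (q - 1) * N (v \<otimes> s) u"
      using N by simp
    ultimately show ?thesis
      using False v sS unfolding qs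
      by (simp add: R_def right_descents_def l) (simp add: algebra_simps)
  qed
qed

lemma R_family_unique:
  assumes P: "R_family G S P" and Q: "R_family G S Q"
  shows "P = Q"
proof (intro ext)
  fix u v
  have *: "P u v = Q u v" if "v \<in> carrier G" "u \<in> carrier G" for u v
    using that
  proof (induction "len v" arbitrary: u v rule: less_induct)
    case less
    show ?case
    proof (cases "v = \<one>")
      case True
      then show ?thesis
        using P Q le_one_iff less.prems unfolding R_family_def by metis
    next
      case False
      then obtain s where s: "s \<in> S" "len v = Suc (len (v \<otimes> s))"
        using descent_exists less.prems by blast
      then have d: "s \<in> right_descents G S v" by (simp add: right_descents_def)
      have "P u' (v \<otimes> s) = Q u' (v \<otimes> s)" if "u' \<in> carrier G" for u'
        using less.hyps [of "v \<otimes> s" u'] s less.prems that by simp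
      then show ?thesis
        using P Q d less.prems s(1) unfolding R_family_def by simp
    qed
  qed
  show "P u v = Q u v"
  proof (cases "le u v")
    case True
    then show ?thesis using * le_carrier by blast
  next
    case False
    then show ?thesis using P Q unfolding R_family_def by simp
  qed
qed

lemma R_poly_eq: "R_poly G S = R"
  unfolding R_poly_def using R_family_R R_family_unique by blast

text \<open>This is the map T_z -> (-q)^l(z) T_(z^(-1))^(-1). Unlike the usual bar involution it
  leaves q alone and is therefore linear over polynomials; the substitution q -> 1/q is carried out
  separately by \<open>reverse_at\<close>.\<close>

definition bar :: "('a \<Rightarrow> int poly) \<Rightarrow> 'a \<Rightarrow> int poly" where
  "bar f u = (\<Sum>z\<in>carrier G. (- 1) ^ len z * f z * N z u)"

lemma supported_bar [simp]: "supported (bar f)"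
  using supported_N by (auto simp: supported_def bar_def intro!: sum.neutral)

lemma linear_bar: "linear_op bar"
  unfolding linear_op_def bar_def
proof (intro allI impI ext)
  fix X :: "'a set" and c :: "'a \<Rightarrow> int poly" and F :: "'a \<Rightarrow> 'a \<Rightarrow> int poly" and u
  have "(\<Sum>z\<in>carrier G. (- 1) ^ len z * (\<Sum>x\<in>X. c x * F x z) * N z u)
      = (\<Sum>z\<in>carrier G. \<Sum>x\<in>X. c x * ((- 1) ^ len z * F x z * N z u))"
    by (simp add: sum_distrib_left sum_distrib_right mult_ac)
  also have "\<dots> = (\<Sum>x\<in>X. c x * (\<Sum>z\<in>carrier G. (- 1) ^ len z * F x z * N z u))"
    by (subst sum.swap) (simp add: sum_distrib_left)
  finally show "(\<Sum>z\<in>carrier G. (- 1) ^ len z * (\<Sum>x\<in>X. c x * F x z) * N z u)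
      = (\<Sum>x\<in>X. c x * (\<Sum>z\<in>carrier G. (- 1) ^ len z * F x z * N z u))" .
qed

lemma bar_add: "bar (\<lambda>u. f u + g u) = (\<lambda>u. bar f u + bar g u)"
  by (simp add: bar_def fun_eq_iff sum.distrib algebra_simps)

lemma bar_delta:
  assumes "w \<in> carrier G"
  shows "bar (delta w) = (\<lambda>u. (- 1) ^ len w * N w u)"
proof
  fix u
  have "bar (delta w) u = (\<Sum>z\<in>carrier G. if z = w then (- 1) ^ len w * N w u else 0)"
    unfolding bar_def by (intro sum.cong) (auto simp: delta_def)
  then show "bar (delta w) u = (- 1) ^ len w * N w u"
    using assms finite_carrier by simp
qed

lemma linear_uminus: "linear_op A \<Longrightarrow> linear_op (\<lambda>f u. - A f u)"
  unfolding linear_op_def by (simp add: sum_negf)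

text \<open>\<open>bar\<close> sends T_s to -q T_s^(-1), so it converts right multiplication by the
  former into right multiplication by the latter. Linearity reduces this to basis elements, with an
  ascent or a descent at s.\<close>

lemma bar_T:
  assumes "s \<in> S" "supported f"
  shows "bar (T s f) = (\<lambda>u. - T_bar s (bar f) u)"
proof (rule linear_op_eqI [OF _ _ assms(2)])
  show "linear_op (\<lambda>f. bar (T s f))"
    by (rule linear_op_comp [OF linear_bar linear_T])
  show "linear_op (\<lambda>f u. - T_bar s (bar f) u)"
    using linear_uminus [OF linear_op_comp [OF linear_T_bar linear_bar]] .
next
  fix z assume z: "z \<in> carrier G"
  have rhs: "T_bar s (bar (delta z)) = (\<lambda>u. (- 1) ^ len z * T_bar s (N z) u)"
    unfolding bar_delta [OF z] by (rule linear_op_scale [OF linear_T_bar])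
  consider "len (z \<otimes> s) = Suc (len z)" | "len z = Suc (len (z \<otimes> s))"
    using len_mult_cases z assms by blast
  then show "bar (T s (delta z)) = (\<lambda>u. - T_bar s (bar (delta z)) u)"
  proof cases
    case 1
    then show ?thesis
      using z assms rhs by (simp add: T_delta_up bar_delta N_mult)
  next
    case 2
    then have "bar (T s (delta z)) = bar (\<lambda>u. q * delta (z \<otimes> s) u + (q - 1) * delta z u)"
      using z assms by (simp add: T_delta_down)
    also have "\<dots> = (\<lambda>u. q * bar (delta (z \<otimes> s)) u + (q - 1) * bar (delta z) u)"
      by (simp add: bar_add linear_op_scale [OF linear_bar])
    also have "\<dots> = (\<lambda>u. - ((- 1) ^ len z * (q * N (z \<otimes> s) u - (q - 1) * N z u)))"
      using z assms 2 by (simp add: bar_delta algebra_simps fun_eq_iff)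
    also have "\<dots> = (\<lambda>u. - T_bar s (bar (delta z)) u)"
      using rhs N_mult_down [of z s] z assms 2 by simp
    finally show ?thesis .
  qed
qed

text \<open>Apply \<open>bar_T\<close> to \<open>T_bar s f\<close>, then \<open>T s\<close> to both
  sides: each acquires a factor q, which cancels.\<close>

lemma bar_T_bar:
  assumes "s \<in> S" "supported f"
  shows "bar (T_bar s f) = (\<lambda>u. - T s (bar f) u)"
proof -
  have "(\<lambda>u. q * bar f u) = bar (T s (T_bar s f))"
    using T_T_bar [OF assms] linear_op_scale [OF linear_bar, of q f] by simp
  also have "\<dots> = (\<lambda>u. - T_bar s (bar (T_bar s f)) u)"
    using bar_T [of s "T_bar s f"] assms by simp
  finally have "T s (\<lambda>u. q * bar f u) = T s (\<lambda>u. (- 1) * T_bar s (bar (T_bar s f)) u)"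
    by simp
  then have "(\<lambda>u. q * T s (bar f) u) = (\<lambda>u. (- 1) * T s (T_bar s (bar (T_bar s f))) u)"
    unfolding linear_op_scale [OF linear_T] .
  also have "\<dots> = (\<lambda>u. - (q * bar (T_bar s f) u))"
    using T_T_bar [of s "bar (T_bar s f)"] assms by simp
  finally have "q * T s (bar f) u = q * - bar (T_bar s f) u" for u
    by (simp add: fun_eq_iff)
  then have "T s (bar f) u = - bar (T_bar s f) u" for u
    using q_neq_0 mult_left_cancel by blast
  then show ?thesis by (simp add: fun_eq_iff)
qed

lemma bar_bar:
  assumes "supported f"
  shows "bar (bar f) = f"
proof (rule linear_op_eqI [of "\<lambda>f. bar (bar f)" "\<lambda>f. f"])
  fix w assume "w \<in> carrier G"
  then show "bar (bar (delta w)) = delta w"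
  proof (induction rule: len_induct)
    case one
    then show ?case by (simp add: bar_delta N_one)
  next
    case (mult w s)
    then have "bar (bar (delta (w \<otimes> s))) = bar (bar (T s (delta w)))"
      by (simp add: T_delta_up)
    also have "\<dots> = bar (\<lambda>u. (- 1) * T_bar s (bar (delta w)) u)"
      using bar_T [of s "delta w"] mult by simp
    also have "\<dots> = (\<lambda>u. (- 1) * bar (T_bar s (bar (delta w))) u)"
      by (rule linear_op_scale [OF linear_bar])
    also have "\<dots> = T s (bar (bar (delta w)))"
      using bar_T_bar [of s "bar (delta w)"] mult by simp
    also have "\<dots> = delta (w \<otimes> s)"
      using mult by (simp add: T_delta_up)
    finally show ?case .
  qed
qed (use assms in \<open>simp_all add: linear_op_comp [OF linear_bar linear_bar] linear_op_def [of "\<lambda>f. f"]\<close>)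

lemma bar_flip:
  assumes "supported f"
  shows "bar (flip f) = flip (bar f)"
proof (rule supported_eqI)
  fix u assume u: "u \<in> carrier G"
  have "bar (flip f) u = (\<Sum>z\<in>carrier G. (- 1) ^ len z * f (inv z) * N z u)"
    by (simp add: bar_def flip_def)
  also have "\<dots> = (\<Sum>z\<in>carrier G. (- 1) ^ len (inv z) * f z * N (inv z) u)"
    by (rule sum.reindex_bij_witness [of _ "\<lambda>z. inv z" "\<lambda>z. inv z"]) auto
  also have "\<dots> = (\<Sum>z\<in>carrier G. (- 1) ^ len z * f z * N z (inv u))"
    using u by (intro sum.cong) (auto simp: flip_def simp flip: flip_N)
  finally show "bar (flip f) u = flip (bar f) u"
    using u by (simp add: bar_def flip_def)
qed simp_all

end

section \<open>Kazhdan--Lusztig columns\<close>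

lemma reverse_at_add_left:
  assumes "degree p \<le> d"
  shows "reverse_at (k + d) p = q ^ k * reverse_at d p"
proof (induction k)
  case (Suc k)
  have "reverse_at (Suc (k + d)) p = q * reverse_at (k + d) p"
    using assms by (intro reverse_at_Suc) auto
  then show ?case using Suc by (simp add: mult.assoc)
qed simp

lemma reverse_at_one: "reverse_at d 1 = q ^ d"
  using reverse_at_eq_reflect_poly [of 1 d] by simp

lemma eq_0_if_reverse_at_eq:
  assumes "reverse_at d p = p" "2 * degree p < d"
  shows "p = 0"
proof -
  have "coeff p (degree p) = coeff p (d - degree p)"
    using arg_cong [OF assms(1), of "\<lambda>r. coeff r (degree p)"] assms(2)
    by (simp add: coeff_reverse_at)
  moreover have "coeff p (d - degree p) = 0"
    using assms(2) by (intro coeff_eq_0) auto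
  ultimately show ?thesis by simp
qed

context finite_coxeter_group
begin

text \<open>For the column \<open>f u = P u v\<close> and \<open>l = len v\<close> this is the defining identity of the
  Kazhdan--Lusztig polynomials. Both sides are multiplied by \<open>q ^ len u\<close>, so that no truncated
  subtraction \<open>l - len u\<close> occurs.\<close>

definition selfdual :: "nat \<Rightarrow> ('a \<Rightarrow> int poly) \<Rightarrow> bool" where
  "selfdual l f \<longleftrightarrow> supported f \<and> (\<forall>u\<in>carrier G. degree (f u) \<le> l \<and>
     reverse_at l (f u) = q ^ len u * ((- 1) ^ len u * bar f u))"

text \<open>Up to normalisation T_s + 1 is the Kazhdan--Lusztig basis element of s. The new value at
  u is f(u) + q f(u s) or f(u s) + q f(u), according to the descent at s; reversal at
  \<open>Suc l\<close> moves the factor q to the other summand, which matches the effect of the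
  identity minus \<open>T_bar s\<close> on \<open>bar f\<close>.\<close>

lemma selfdual_T:
  assumes "selfdual l f" "s \<in> S"
  shows "selfdual (Suc l) (\<lambda>u. T s f u + f u)"
  unfolding selfdual_def
proof (intro conjI ballI)
  have f: "supported f" using assms by (simp add: selfdual_def)
  then show "supported (\<lambda>u. T s f u + f u)"
    using supported_T [of s f] by (simp add: supported_def)
  fix u assume u: "u \<in> carrier G"
  have bar: "bar (\<lambda>u. T s f u + f u) u = bar f u - T_bar s (bar f) u"
    by (simp add: bar_add bar_T assms f)
  have deg: "degree (f u) \<le> l" "degree (f (u \<otimes> s)) \<le> l"
    using assms u by (auto simp: selfdual_def)
  have rev: "reverse_at l (f u) = q ^ len u * ((- 1) ^ len u * bar f u)"
    "reverse_at l (f (u \<otimes> s)) = q ^ len (u \<otimes> s) * ((- 1) ^ len (u \<otimes> s) * bar f (u \<otimes> s))"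
    using assms u by (auto simp: selfdual_def)
  consider "len u = Suc (len (u \<otimes> s))" | "len (u \<otimes> s) = Suc (len u)"
    using len_mult_cases u assms by blast
  then have "degree (T s f u + f u) \<le> Suc l \<and> reverse_at (Suc l) (T s f u + f u) =
      q ^ len u * ((- 1) ^ len u * (bar f u - T_bar s (bar f) u))"
  proof cases
    case 1
    then have eq: "T s f u + f u = f (u \<otimes> s) + q * f u"
      using u by (simp add: T_def algebra_simps)
    have "reverse_at (Suc l) (f (u \<otimes> s) + q * f u) =
        q * reverse_at l (f (u \<otimes> s)) + reverse_at l (f u)"
      using deg by (simp add: reverse_at_add reverse_at_Suc reverse_at_Suc_q_mult)
    also have "\<dots> = q ^ len u * ((- 1) ^ len u * (bar f u - T_bar s (bar f) u))"
      unfolding rev using u 1 by (simp add: T_bar_def algebra_simps)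
    finally show ?thesis using degree_T_le(1) [OF deg(2,1)] unfolding eq by simp
  next
    case 2
    then have eq: "T s f u + f u = f u + q * f (u \<otimes> s)"
      using u by (simp add: T_def algebra_simps)
    have "reverse_at (Suc l) (f u + q * f (u \<otimes> s)) =
        q * reverse_at l (f u) + reverse_at l (f (u \<otimes> s))"
      using deg by (simp add: reverse_at_add reverse_at_Suc reverse_at_Suc_q_mult)
    also have "\<dots> = q ^ len u * ((- 1) ^ len u * (bar f u - T_bar s (bar f) u))"
      unfolding rev 2 using u 2 by (simp add: T_bar_def algebra_simps)
    finally show ?thesis using degree_T_le(1) [OF deg] unfolding eq by simp
  qed
  then show "degree (T s f u + f u) \<le> Suc l" "reverse_at (Suc l) (T s f u + f u) =
      q ^ len u * ((- 1) ^ len u * bar (\<lambda>u. T s f u + f u) u)"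
    unfolding bar by auto
qed

lemma selfdual_flip: "selfdual l f \<Longrightarrow> selfdual l (flip f)"
  by (simp add: selfdual_def bar_flip) (simp add: flip_def)

text \<open>Of the two additional degrees, one absorbs the factor q under reversal and the other
  produces it on the right-hand side.\<close>

lemma selfdual_q_mult:
  assumes "selfdual l f"
  shows "selfdual (Suc (Suc l)) (\<lambda>u. q * f u)"
proof -
  have "degree (q * f u) \<le> Suc (Suc l)" if "u \<in> carrier G" for u
    using assms that degree_q_mult_le [of "f u" l] by (auto simp: selfdual_def)
  moreover have "bar (\<lambda>u. q * f u) u = q * bar f u" for u
    using linear_op_scale [OF linear_bar, of q f] by simp
  moreover have "supported (\<lambda>u. q * f u)"
    using assms by (auto simp: selfdual_def supported_def)
  ultimately show ?thesis
    using assms by (simp add: selfdual_def reverse_at_Suc_q_mult reverse_at_Suc)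
qed

lemma bar_diff: "bar (\<lambda>u. f u - g u) = (\<lambda>u. bar f u - bar g u)"
  by (simp add: bar_def fun_eq_iff sum_subtractf algebra_simps)

lemma selfdual_diff: "\<lbrakk>selfdual l f; selfdual l g\<rbrakk> \<Longrightarrow> selfdual l (\<lambda>u. f u - g u)"
  by (simp add: selfdual_def bar_diff supported_def reverse_at_diff right_diff_distrib degree_diff_le)

text \<open>In \<open>KL_family\<close> the identity for a pair (u, v) involves only entries with
  the same v, so the conditions decouple into columns. A boolean column can thus be verified without
  reference to any other.\<close>

definition KL_column :: "'a \<Rightarrow> ('a \<Rightarrow> int poly) \<Rightarrow> bool" where
  "KL_column v c \<longleftrightarrow> v \<in> carrier G \<and> selfdual (len v) c \<and> (\<forall>u. \<not> le u v \<longrightarrow> c u = 0) \<and> c v = 1 \<and>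
     (\<forall>u. le u v \<longrightarrow> u \<noteq> v \<longrightarrow> 2 * degree (c u) + 1 \<le> len v - len u)"

lemma N_nonzero_imp_len:
  assumes "z \<in> carrier G" "N z u \<noteq> 0"
  shows "z = u \<or> len u < len z"
  using N_nonzero_imp_le [OF assms] le_len by blast

text \<open>\<open>N z u\<close> is nonzero only if z = u or z is longer than u, so a single summand
  survives.\<close>

lemma bar_triangular:
  assumes "u \<in> carrier G" and "\<And>z. \<lbrakk>z \<in> carrier G; len u < len z\<rbrakk> \<Longrightarrow> f z = 0"
  shows "bar f u = (- 1) ^ len u * f u"
proof -
  have "bar f u = (\<Sum>z\<in>carrier G. if z = u then (- 1) ^ len u * f u else 0)"
    unfolding bar_def using assms(2) N_nonzero_imp_len N_diag [OF assms(1)]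
    by (intro sum.cong) auto
  then show ?thesis using assms(1) finite_carrier by simp
qed

lemma bar_eq_0:
  assumes "\<And>z. \<not> le z v \<Longrightarrow> c z = 0" "\<not> le u v"
  shows "bar c u = 0"
  unfolding bar_def
proof (intro sum.neutral ballI)
  fix z assume "z \<in> carrier G"
  then have "c z = 0 \<or> N z u = 0"
    using assms N_nonzero_imp_le le_trans by blast
  then show "(- 1) ^ len z * c z * N z u = 0" by auto
qed

text \<open>Downward induction on the length of u. If the difference D vanishes on all longer
  elements, then \<open>bar_triangular\<close> makes \<open>D u\<close> palindromic with respect to
  d = l(v) - l(u), while the degree bounds keep it below d/2; so it is 0.\<close>

lemma KL_column_unique:
  assumes c: "KL_column v c" and d: "KL_column v d"
  shows "c = d"
proof -
  define D where "D = (\<lambda>u. c u - d u)"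
  have sd: "selfdual (len v) D"
    using c d selfdual_diff unfolding D_def KL_column_def by blast
  have nle: "D u = 0" if "\<not> le u v" for u
    using that c d by (simp add: D_def KL_column_def)
  have "D u = 0" if "u \<in> carrier G" for u
    using that
  proof (induction "len v - len u" arbitrary: u rule: less_induct)
    case less
    show ?case
    proof (cases "le u v \<and> u \<noteq> v")
      case True
      have lt: "len u < len v" using True le_len by blast
      have "D z = 0" if "z \<in> carrier G" "len u < len z" for z
        using nle [of z] less.hyps [of z] that lt by (cases "le z v") auto
      then have "bar D u = (- 1) ^ len u * D u"
        using bar_triangular less.prems by blast
      then have "reverse_at (len v) (D u) = q ^ len u * D u"
        using sd less.prems unfolding selfdual_def by simp
      from reverse_at_shift [OF this] lt have rev: "reverse_at (len v - len u) (D u) = D u"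
        by simp
      have "2 * degree (c u) + 1 \<le> len v - len u" "2 * degree (d u) + 1 \<le> len v - len u"
        using c d True by (auto simp: KL_column_def)
      then have "2 * degree (D u) < len v - len u"
        using degree_diff_le_max [of "c u" "d u"] unfolding D_def by linarith
      then show ?thesis using eq_0_if_reverse_at_eq rev by blast
    next
      case False
      then show ?thesis using nle c d by (auto simp: D_def KL_column_def)
    qed
  qed
  moreover have "D u = 0" if "u \<notin> carrier G" for u
    using that nle le_carrier by blast
  ultimately show ?thesis by (auto simp: D_def fun_eq_iff)
qed

text \<open>The antisymmetry below is what allows the next value of a Kazhdan--Lusztig column to be
  defined as minus the low-degree half of the value forced by the larger elements.\<close>

lemma reverse_at_bar_antisymmetric:
  assumes sup: "supported c" and u: "u \<in> carrier G" "len u \<le> l" and cu: "c u = 0"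
    and c: "\<And>z. \<lbrakk>z \<in> carrier G; len u < len z\<rbrakk> \<Longrightarrow> degree (c z) \<le> l \<and>
      reverse_at l (c z) = q ^ len z * ((- 1) ^ len z * bar c z)"
  shows "reverse_at (l - len u) (bar c u) = - bar c u"
proof -
  let ?X = "carrier G - {u}"
  have split: "(\<Sum>z\<in>carrier G. h z) = h u + (\<Sum>z\<in>?X. h z)" for h :: "'a \<Rightarrow> int poly"
    using u finite_carrier by (simp add: sum.remove)
  have "0 = bar (bar c) u"
    using bar_bar [OF sup] cu by simp
  also have "\<dots> = (\<Sum>z\<in>carrier G. (- 1) ^ len z * bar c z * N z u)"
    by (simp add: bar_def [of "bar c"])
  finally have *: "(\<Sum>z\<in>?X. (- 1) ^ len z * bar c z * N z u) = - ((- 1) ^ len u * bar c u)"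
    using N_diag [OF u(1)] unfolding split by (simp add: eq_neg_iff_add_eq_0 add.commute)
  have rev: "reverse_at l (c z * N z u) = q ^ len u * ((- 1) ^ len u * (bar c z * N z u))"
    if z: "z \<in> ?X" for z
  proof (cases "c z = 0 \<or> N z u = 0")
    case True
    then show ?thesis
    proof
      assume "c z = 0"
      show ?thesis
      proof (cases "N z u = 0")
        case False
        then have "len u < len z" using N_nonzero_imp_len [of z u] z by auto
        then have "q ^ len z * ((- 1) ^ len z * bar c z) = 0"
          using c [of z] z \<open>c z = 0\<close> by simp
        then show ?thesis using \<open>c z = 0\<close> by simp
      qed simp
    qed simp
  next
    case False
    then have lt: "len u < len z" using N_nonzero_imp_len [of z u] z by auto
    have cz: "degree (c z) \<le> l" "reverse_at l (c z) = q ^ len z * ((- 1) ^ len z * bar c z)"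
      using c [of z] z lt by auto
    have Nz: "degree (N z u) \<le> len z"
      "reverse_at (len z) (N z u) = (- 1) ^ (len z + len u) * q ^ len u * N z u"
      using reverse_at_N [of z u] z u by auto
    \<comment> \<open>The hypothesis only gives degree at most l. This stronger bound ensures that
      the product with \<open>N z u\<close> can still be reversed at l.\<close>
    have "degree (c z) + len z \<le> l"
      using degree_le_if_reverse_at_eq [OF cz(2,1)] False by simp
    then have "degree (c z * N z u) \<le> l"
      using Nz(1) degree_mult_le [of "c z" "N z u"] by linarith
    then have "q ^ len z * reverse_at l (c z * N z u) = reverse_at (l + len z) (c z * N z u)"
      using reverse_at_add_left by (metis add.commute)
    also have "\<dots> = reverse_at l (c z) * reverse_at (len z) (N z u)"
      by (rule reverse_at_mult [OF cz(1) Nz(1)])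
    also have "\<dots> = q ^ len z * (q ^ len u * ((- 1) ^ len u * (bar c z * N z u)))"
      unfolding cz(2) Nz(2) by (simp add: power_add mult_ac)
    finally show ?thesis by simp
  qed
  have "bar c u = (\<Sum>z\<in>?X. (- 1) ^ len z * c z * N z u)"
    unfolding bar_def split by (simp add: cu)
  then have "reverse_at l (bar c u) = (\<Sum>z\<in>?X. (- 1) ^ len z * reverse_at l (c z * N z u))"
    by (simp add: reverse_at_sum mult.assoc reverse_at_sign)
  also have "\<dots> = (\<Sum>z\<in>?X. q ^ len u * (- 1) ^ len u * ((- 1) ^ len z * bar c z * N z u))"
    using rev by (intro sum.cong) (simp_all add: mult_ac)
  also have "\<dots> = q ^ len u * (- 1) ^ len u * (\<Sum>z\<in>?X. (- 1) ^ len z * bar c z * N z u)"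
    by (simp add: sum_distrib_left)
  also have "\<dots> = q ^ len u * - bar c u"
    unfolding * by (simp flip: mult.assoc power_add)
  finally show ?thesis
    using u(2) by (rule reverse_at_shift)
qed

text \<open>Entries are filled in by decreasing length: at stage k those of length at least
  \<open>len v - k\<close> are final, and all shorter ones hold the placeholder 0, which is the
  condition \<open>cu\<close> of the antisymmetry lemma.\<close>

lemma KL_column_exists:
  assumes v: "v \<in> carrier G"
  shows "\<exists>c. KL_column v c"
proof -
  let ?l = "len v"
  have "\<exists>c. supported c \<and> (\<forall>u. \<not> le u v \<longrightarrow> c u = 0) \<and> c v = 1 \<and>
      (\<forall>u. le u v \<longrightarrow> u \<noteq> v \<longrightarrow> 2 * degree (c u) + 1 \<le> ?l - len u) \<and>
      (\<forall>u\<in>carrier G. len u + k < ?l \<longrightarrow> c u = 0) \<and>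
      (\<forall>u\<in>carrier G. ?l \<le> len u + k \<longrightarrow> degree (c u) \<le> ?l \<and>
         reverse_at ?l (c u) = q ^ len u * ((- 1) ^ len u * bar c u))" for k
  proof (induction k)
    case 0
    have "reverse_at ?l (delta v u) = q ^ len u * ((- 1) ^ len u * bar (delta v) u)"
      if "u \<in> carrier G" "?l \<le> len u" for u
    proof (cases "u = v")
      case True
      then show ?thesis
        using v by (simp add: bar_delta delta_def reverse_at_one N_diag flip: mult.assoc power_add)
    next
      case False
      then have "N v u = 0" using N_nonzero_imp_len [OF v, of u] that by auto
      then show ?thesis using v False by (simp add: bar_delta delta_def)
    qed
    moreover have "delta v v = 1" and nz: "u \<noteq> v \<Longrightarrow> delta v u = 0" for u
      by (simp_all add: delta_def)
    moreover have "1 \<le> ?l - len u" if "le u v" "u \<noteq> v" for u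
      using le_len [OF that(1)] that(2) by simp
    moreover have "degree (delta v u) = 0" for u
      by (simp add: delta_def)
    ultimately show ?case
      using supported_delta [OF v] le_refl [OF v]
      by (intro exI [of _ "delta v"] conjI allI impI ballI) (simp | metis add_0_right less_irrefl)+
  next
    case (Suc k)
    then obtain c where sup: "supported c" and nle: "\<forall>u. \<not> le u v \<longrightarrow> c u = 0" and cv: "c v = 1"
      and deg: "\<forall>u. le u v \<longrightarrow> u \<noteq> v \<longrightarrow> 2 * degree (c u) + 1 \<le> ?l - len u"
      and zero: "\<forall>u\<in>carrier G. len u + k < ?l \<longrightarrow> c u = 0"
      and rev: "\<forall>u\<in>carrier G. ?l \<le> len u + k \<longrightarrow> degree (c u) \<le> ?l \<and>
         reverse_at ?l (c u) = q ^ len u * ((- 1) ^ len u * bar c u)"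
      by blast
    define new where "new = (\<lambda>u. u \<in> carrier G \<and> ?l = len u + Suc k)"
    \<comment> \<open>The new value p must satisfy rev(p) = Q + p, where Q is the antisymmetric
      contribution of the larger elements. By \<open>reverse_at_low_part\<close>, minus the low half
      of Q is a solution, and it meets the degree bound.\<close>
    define c' where "c' = (\<lambda>u. if new u then - low_part (Suc k) ((- 1) ^ len u * bar c u) else c u)"
    have c'_eq: "c' = (\<lambda>u. c u + (c' u - c u))" by simp
    have bar': "bar c' u = bar c u + (if new u then (- 1) ^ len u * c' u else 0)"
      if u: "u \<in> carrier G" "?l \<le> len u + Suc k" for u
    proof -
      have "bar c' u = bar c u + bar (\<lambda>u. c' u - c u) u"
        using c'_eq bar_add by metis
      also have "bar (\<lambda>u. c' u - c u) u = (- 1) ^ len u * (c' u - c u)"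
        using u by (intro bar_triangular) (auto simp: c'_def new_def)
      finally show ?thesis
        using zero u by (auto simp: c'_def new_def)
    qed
    have Q0: "bar c u = 0" if "\<not> le u v" for u
      using bar_eq_0 nle that by blast
    have low0: "low_part d 0 = 0" for d
      by (simp add: poly_eq_iff coeff_low_part)
    have rev': "degree (c' u) \<le> ?l \<and>
         reverse_at ?l (c' u) = q ^ len u * ((- 1) ^ len u * bar c' u)"
      if u: "u \<in> carrier G" "?l \<le> len u + Suc k" for u
    proof (cases "new u")
      case False
      then have "?l \<le> len u + k" using u by (auto simp: new_def)
      then show ?thesis using rev u bar' [OF u] False by (simp add: c'_def)
    next
      case True
      let ?Q = "(- 1) ^ len u * bar c u"
      have l: "?l = len u + Suc k" using True by (simp add: new_def)
      have "reverse_at (?l - len u) (bar c u) = - bar c u"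
        using rev zero u l by (intro reverse_at_bar_antisymmetric sup) auto
      then have "reverse_at (Suc k) ?Q = - ?Q"
        using l by (simp add: reverse_at_sign)
      then have low: "reverse_at (Suc k) (c' u) = ?Q + c' u"
        using reverse_at_low_part True by (simp add: c'_def)
      have d: "degree (c' u) \<le> Suc k"
        using degree_low_part [of "Suc k" ?Q] True by (simp add: c'_def)
      have "reverse_at ?l (c' u) = q ^ len u * (?Q + c' u)"
        using reverse_at_add_left [OF d, of "len u"] low l by simp
      also have "?Q + c' u = (- 1) ^ len u * bar c' u"
        using bar' [OF u] True by (simp add: distrib_left flip: mult.assoc power_add)
      finally show ?thesis using d l by simp
    qed
    have "supported c'"
      using sup by (auto simp: supported_def c'_def new_def)
    moreover have "c' u = 0" if "\<not> le u v" for u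
      using nle Q0 that low0 by (simp add: c'_def)
    moreover have "c' v = 1"
      using cv by (simp add: c'_def new_def)
    moreover have "2 * degree (c' u) + 1 \<le> ?l - len u" if "le u v" "u \<noteq> v" for u
      using deg degree_low_part [of "Suc k" "(- 1) ^ len u * bar c u"] that
      by (auto simp: c'_def new_def)
    moreover have "c' u = 0" if "u \<in> carrier G" "len u + Suc k < ?l" for u
      using that zero by (simp add: c'_def new_def)
    ultimately show ?case
      using rev' by (intro exI [of _ c']) blast
  qed
  \<comment> \<open>At stage \<open>len v\<close> no placeholder remains.\<close>
  from this [of ?l] obtain c where "supported c" "\<forall>u. \<not> le u v \<longrightarrow> c u = 0" "c v = 1"
      "\<forall>u. le u v \<longrightarrow> u \<noteq> v \<longrightarrow> 2 * degree (c u) + 1 \<le> ?l - len u"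
      "\<forall>u\<in>carrier G. ?l \<le> len u + ?l \<longrightarrow> degree (c u) \<le> ?l \<and>
         reverse_at ?l (c u) = q ^ len u * ((- 1) ^ len u * bar c u)"
    by blast
  then have "KL_column v c"
    using v unfolding KL_column_def selfdual_def by (metis le_add2)
  then show ?thesis by blast
qed

lemma bar_eq_sum_R:
  assumes "u \<in> carrier G" and "\<And>z. \<not> le z v \<Longrightarrow> c z = 0"
  shows "(- 1) ^ len u * bar c u = (\<Sum>z | le u z \<and> le z v. R u z * c z)"
proof -
  have "(- 1) ^ len u * bar c u = (\<Sum>z\<in>carrier G. R u z * c z)"
    by (simp add: bar_def R_def sum_distrib_left power_add mult_ac)
  also have "\<dots> = (\<Sum>z | le u z \<and> le z v. R u z * c z)"
  proof (rule sum.mono_neutral_right [OF finite_carrier])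
    show "{z. le u z \<and> le z v} \<subseteq> carrier G" using le_carrier by auto
    show "\<forall>z\<in>carrier G - {z. le u z \<and> le z v}. R u z * c z = 0"
      using R_family_R assms(2) unfolding R_family_def by auto
  qed
  finally show ?thesis .
qed

lemma KL_family_exists: "\<exists>P. KL_family G S P"
proof
  define P where "P = (\<lambda>u v. if v \<in> carrier G then (SOME c. KL_column v c) u else 0)"
  have P: "KL_column v (\<lambda>u. P u v)" if "v \<in> carrier G" for v
    using someI_ex [OF KL_column_exists [OF that]] that by (simp add: P_def)
  have rev: "reverse_at (len v - len u) (P u v) = (\<Sum>z | le u z \<and> le z v. R u z * P z v)"
    if "le u v" for u v
  proof (rule reverse_at_shift)
    have v: "KL_column v (\<lambda>u. P u v)" using P le_carrier that by blast
    then show "reverse_at (len v) (P u v) = q ^ len u * (\<Sum>z | le u z \<and> le z v. R u z * P z v)"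
      using le_carrier [OF that] bar_eq_sum_R [of u v "\<lambda>u. P u v"]
      by (simp add: KL_column_def selfdual_def)
  qed (use that le_len' in auto)
  have nle: "P u v = 0" if "\<not> le u v" for u v
  proof (cases "v \<in> carrier G")
    case True
    then show ?thesis using P that unfolding KL_column_def by blast
  qed (simp add: P_def)
  have diag: "P v v = 1" if "v \<in> carrier G" for v
    using P [OF that] unfolding KL_column_def by blast
  have deg: "2 * degree (P u v) + 1 \<le> len v - len u" if "le u v" "u \<noteq> v" for u v
    using P [OF le_carrier(2) [OF that(1)]] that unfolding KL_column_def by blast
  show "KL_family G S P"
    unfolding KL_family_def R_poly_eq using nle diag deg rev by blast
qed

lemma KL_family_imp_KL_column:
  assumes P: "KL_family G S P" and v: "v \<in> carrier G"
  shows "KL_column v (\<lambda>u. P u v)"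
proof -
  let ?c = "\<lambda>u. P u v"
  have nle: "\<And>u. \<not> le u v \<Longrightarrow> ?c u = 0" and diag: "?c v = 1"
    and deg: "\<And>u. \<lbrakk>le u v; u \<noteq> v\<rbrakk> \<Longrightarrow> 2 * degree (?c u) + 1 \<le> len v - len u"
    and rev: "\<And>u. le u v \<Longrightarrow>
      reverse_at (len v - len u) (?c u) = (\<Sum>z | le u z \<and> le z v. R u z * ?c z)"
    using P v unfolding KL_family_def R_poly_eq by auto
  have "degree (?c u) \<le> len v \<and>
      reverse_at (len v) (?c u) = q ^ len u * ((- 1) ^ len u * bar ?c u)"
    if u: "u \<in> carrier G" for u
  proof (cases "le u v")
    case False
    then have "bar ?c u = 0" using bar_eq_0 [of v ?c u] nle by simp
    then show ?thesis using nle False by simp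
  next
    case True
    have d: "degree (?c u) \<le> len v - len u"
      using deg [OF True] diag by (cases "u = v") auto
    have "reverse_at (len v) (?c u) = q ^ len u * reverse_at (len v - len u) (?c u)"
      using reverse_at_add_left [OF d, of "len u"] le_len' [OF True] by simp
    then show ?thesis
      using d rev [OF True] bar_eq_sum_R [of u v ?c] u nle by simp
  qed
  moreover have "supported ?c"
    unfolding supported_def using nle le_carrier by blast
  ultimately show ?thesis
    unfolding KL_column_def selfdual_def using v nle diag deg by auto
qed

text \<open>Uniqueness holds column by column, and \<open>KL_family_exists\<close> supplies a full
  family; together they unlock the definite description.\<close>

theorem KL_poly_eq_column:
  assumes "KL_column v c"
  shows "KL_poly G S u v = c u"
proof -
  have uniq: "P = P'" if "KL_family G S P" "KL_family G S P'" for P P'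
  proof (intro ext)
    fix u v
    show "P u v = P' u v"
    proof (cases "v \<in> carrier G")
      case True
      then show ?thesis
        using KL_column_unique KL_family_imp_KL_column that by metis
    next
      case False
      then have "\<not> le u v" using le_carrier by blast
      then show ?thesis using that by (simp add: KL_family_def)
    qed
  qed
  then have "KL_family G S (KL_poly G S)"
    unfolding KL_poly_def using KL_family_exists by (metis theI')
  then have "KL_column v (\<lambda>u. KL_poly G S u v)"
    using KL_family_imp_KL_column assms unfolding KL_column_def by blast
  then show ?thesis using KL_column_unique assms by metis
qed

end

section \<open>The symmetric group as a Coxeter group\<close>

definition inversions :: "nat \<Rightarrow> (nat \<Rightarrow> nat) \<Rightarrow> (nat \<times> nat) set" where
  "inversions m w = {(i, j). 1 \<le> i \<and> i < j \<and> j \<le> m \<and> w j < w i}"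

lemma finite_inversions [simp]: "finite (inversions m w)"
  by (rule finite_subset [of _ "{1..m} \<times> {1..m}"]) (auto simp: inversions_def)

lemma transpose_apply_inj: "inj f \<Longrightarrow> transpose (f a) (f b) (f x) = f (transpose a b x)"
  by (auto simp: transpose_def inj_eq)

lemma permutes_in_range:
  assumes "w permutes {1..m}" "1 \<le> i" "i \<le> m"
  shows "1 \<le> w i" "w i \<le> m"
  using permutes_in_image [OF assms(1), of i] assms by auto

text \<open>Inversions of x are injected into those of x t: a pair is moved by t if this keeps its
  order and is left in place otherwise. The new inversion (a, b) is never hit.\<close>

lemma card_inversions_transpose:
  assumes "x permutes {1..m}" "1 \<le> a" "a < b" "b \<le> m" "x a < x b"
  shows "card (inversions m x) < card (inversions m (x \<circ> transpose a b))"
proof -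
  let ?t = "transpose a b"
  define f where "f = (\<lambda>(i, j). if ?t i < ?t j then (?t i, ?t j) else (i, j))"
  have t: "?t permutes {1..m}"
    using assms by (intro permutes_swap_id) auto
  have into: "f (i, j) \<in> inversions m (x \<circ> ?t)" if ij: "(i, j) \<in> inversions m x" for i j
  proof (cases "?t i < ?t j")
    case True
    then show ?thesis
      using ij permutes_in_range [OF t, of i] permutes_in_range [OF t, of j]
      by (auto simp: f_def inversions_def)
  next
    case False
    then show ?thesis
      using ij assms by (auto simp: f_def inversions_def transpose_def split: if_splits)
  qed
  have inj: "inj_on f (inversions m x)"
  proof (intro inj_onI)
    fix p p' assume "p \<in> inversions m x" "p' \<in> inversions m x" "f p = f p'"
    then show "p = p'"
      using inj_eq [OF permutes_inj [OF t]]
      by (cases p; cases p') (auto simp: f_def inversions_def split: if_splits)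
  qed
  have "(a, b) \<notin> f ` inversions m x"
  proof
    assume "(a, b) \<in> f ` inversions m x"
    then obtain i j where ij: "(i, j) \<in> inversions m x" "f (i, j) = (a, b)"
      by auto
    show False
    proof (cases "?t i < ?t j")
      case True
      then have "?t i = a" "?t j = b" using ij by (auto simp: f_def)
      then have "i = b" "j = a" by (auto simp: transpose_eq_iff)
      then show False using ij assms by (auto simp: inversions_def)
    next
      case False
      then show False using ij assms by (auto simp: f_def inversions_def)
    qed
  qed
  moreover have "(a, b) \<in> inversions m (x \<circ> ?t)"
    using assms by (auto simp: inversions_def)
  ultimately have "f ` inversions m x \<subset> inversions m (x \<circ> ?t)"
    using into by auto
  then have "card (f ` inversions m x) < card (inversions m (x \<circ> ?t))"
    by (intro psubset_card_mono) auto
  then show ?thesis using card_image [OF inj] by simp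
qed

lemma card_inversions_transpose_iff:
  assumes "x permutes {1..m}" "1 \<le> a" "a < b" "b \<le> m"
  shows "card (inversions m x) < card (inversions m (x \<circ> transpose a b)) \<longleftrightarrow> x a < x b"
proof
  assume less: "card (inversions m x) < card (inversions m (x \<circ> transpose a b))"
  show "x a < x b"
  proof (rule ccontr)
    assume "\<not> x a < x b"
    moreover have "x a \<noteq> x b"
      using permutes_inj [OF assms(1)] assms by (auto simp: inj_eq)
    moreover have "x \<circ> transpose a b permutes {1..m}"
      using assms by (intro permutes_compose permutes_swap_id) auto
    ultimately have "card (inversions m (x \<circ> transpose a b))
        < card (inversions m (x \<circ> transpose a b \<circ> transpose a b))"
      using assms by (intro card_inversions_transpose) auto
    then show False using less by (simp add: comp_assoc)
  qed
qed (use card_inversions_transpose assms in blast)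

text \<open>An adjacent transposition preserves the order of every pair of positions except (i, i +
  1), so applying it to both coordinates injects all other inversions.\<close>

lemma card_inversions_simple_le:
  assumes "1 \<le> i" "i < m"
  shows "card (inversions m (x \<circ> transpose i (i + 1))) \<le> Suc (card (inversions m x))"
proof -
  let ?s = "transpose i (i + 1)"
  let ?X = "inversions m (x \<circ> ?s) - {(i, i + 1)}"
  have "inj_on (map_prod ?s ?s) ?X"
    by (intro inj_on_subset [OF map_prod_inj_on]) (auto intro: inj_onI)
  moreover have "map_prod ?s ?s ` ?X \<subseteq> inversions m x"
  proof (intro subsetI, elim imageE)
    fix p p' assume "p' \<in> ?X" "p = map_prod ?s ?s p'"
    moreover obtain k l where "p' = (k, l)" by (cases p')
    ultimately show "p \<in> inversions m x"
      using assms by (auto simp: inversions_def transpose_def split: if_splits)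
  qed
  ultimately have "card ?X \<le> card (inversions m x)"
    by (intro card_inj_on_le [of "map_prod ?s ?s"]) auto
  moreover have "card (inversions m (x \<circ> ?s)) \<le> Suc (card ?X)"
    using card_Diff1_le [of "inversions m (x \<circ> ?s)" "(i, i + 1)"]
    by (auto simp: card_Diff_singleton_if)
  ultimately show ?thesis by linarith
qed

lemma word_prod_sym_append:
  "word_prod (sym_group m) (us @ ws) = word_prod (sym_group m) us \<circ> word_prod (sym_group m) ws"
  by (induction us) (simp_all add: sym_group_def comp_assoc)

lemma transpose_permutes: "\<lbrakk>1 \<le> i; i \<le> n\<rbrakk> \<Longrightarrow> transpose i (i + 1) permutes {1..n + 1}"
  for i n :: nat
  by (intro permutes_swap_id) auto

lemma inversions_le_length:
  "set ws \<subseteq> simple_transpositions n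
   \<Longrightarrow> card (inversions (n + 1) (word_prod (sym_group (n + 1)) ws)) \<le> length ws"
proof (induction ws rule: rev_induct)
  case Nil
  have "inversions (n + 1) (word_prod (sym_group (n + 1)) []) = {}"
    by (auto simp: inversions_def sym_group_one)
  then show ?case by (metis card.empty le0)
next
  case (snoc s ws)
  then obtain i where i: "s = transpose i (i + 1)" "1 \<le> i" "i \<le> n"
    by (auto simp: simple_transpositions_def)
  let ?w = "word_prod (sym_group (n + 1)) ws"
  have eq: "word_prod (sym_group (n + 1)) (ws @ [s]) = ?w \<circ> s"
    by (simp add: word_prod_sym_append) (simp add: sym_group_def)
  have "card (inversions (n + 1) (?w \<circ> s)) \<le> Suc (card (inversions (n + 1) ?w))"
    using i card_inversions_simple_le [of i "n + 1" ?w] by simp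
  also have "\<dots> \<le> length (ws @ [s])"
    using snoc by simp
  finally show ?case unfolding eq .
qed

lemma descent_position_exists:
  fixes w :: "nat \<Rightarrow> nat"
  assumes "w permutes {1..n + 1}" "w \<noteq> id"
  obtains i where "1 \<le> i" "i \<le> n" "w (i + 1) < w i"
proof -
  have "\<exists>i. 1 \<le> i \<and> i \<le> n \<and> w (i + 1) < w i"
  proof (rule ccontr)
    assume none: "\<not> ?thesis"
    have up: "w i < w (i + 1)" if "1 \<le> i" "i \<le> n" for i
    proof -
      have "w i \<noteq> w (i + 1)" by (simp add: inj_eq [OF permutes_inj [OF assms(1)]])
      moreover have "\<not> w (i + 1) < w i" using none that by blast
      ultimately show ?thesis by linarith
    qed
    have "k \<le> w k" if "1 \<le> k" "k \<le> n + 1" for k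
      using that
    proof (induction k rule: dec_induct)
      case base
      then show ?case using permutes_in_range [OF assms(1), of 1] by simp
    next
      case (step k)
      then show ?case using up [of k] by simp
    qed
    then have "w = id"
      using permutes_natset_ge [OF assms(1)] by simp
    then show False using assms by simp
  qed
  then show thesis using that by blast
qed

lemma word_of_length_inversions:
  assumes "w permutes {1..n + 1}"
  shows "\<exists>ws. set ws \<subseteq> simple_transpositions n \<and> length ws = card (inversions (n + 1) w)
    \<and> word_prod (sym_group (n + 1)) ws = w"
  using assms
proof (induction "card (inversions (n + 1) w)" arbitrary: w rule: less_induct)
  case less
  show ?case
  proof (cases "w = id")
    case True
    then have "inversions (n + 1) w = {}" by (auto simp: inversions_def)
    then show ?thesis using True by (intro exI [of _ "[]"]) (simp add: sym_group_one)
  next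
    case False
    then obtain i where i: "1 \<le> i" "i \<le> n" "w (i + 1) < w i"
      using descent_position_exists less.prems by blast
    let ?s = "transpose i (i + 1)"
    have s: "?s permutes {1..n + 1}" using transpose_permutes i by blast
    have w': "w \<circ> ?s permutes {1..n + 1}"
      using permutes_compose [OF s less.prems] .
    have "card (inversions (n + 1) (w \<circ> ?s)) < card (inversions (n + 1) (w \<circ> ?s \<circ> ?s))"
      using i by (intro card_inversions_transpose w') auto
    then have lt: "card (inversions (n + 1) (w \<circ> ?s)) < card (inversions (n + 1) w)"
      by (simp add: comp_assoc)
    have "card (inversions (n + 1) (w \<circ> ?s \<circ> ?s)) \<le> Suc (card (inversions (n + 1) (w \<circ> ?s)))"
      using i by (intro card_inversions_simple_le) auto
    then have eq: "card (inversions (n + 1) w) = Suc (card (inversions (n + 1) (w \<circ> ?s)))"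
      using lt by (simp add: comp_assoc)
    obtain ws where ws: "set ws \<subseteq> simple_transpositions n"
      "length ws = card (inversions (n + 1) (w \<circ> ?s))"
      "word_prod (sym_group (n + 1)) ws = w \<circ> ?s"
      using less.hyps [OF lt w'] by blast
    have "word_prod (sym_group (n + 1)) (ws @ [?s]) = w \<circ> ?s \<circ> ?s"
      using ws by (simp add: word_prod_sym_append) (simp add: sym_group_def)
    then show ?thesis
      using ws i eq
      by (intro exI [of _ "ws @ [?s]"]) (auto simp: comp_assoc simple_transpositions_def)
  qed
qed

lemma cox_length_eq_inversions:
  assumes "w permutes {1..n + 1}"
  shows "cox_length (sym_group (n + 1)) (simple_transpositions n) w = card (inversions (n + 1) w)"
  unfolding cox_length_def
proof (rule Least_equality)
  show "\<exists>ws. set ws \<subseteq> simple_transpositions n \<and> length ws = card (inversions (n + 1) w)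
    \<and> word_prod (sym_group (n + 1)) ws = w"
    using word_of_length_inversions assms by blast
qed (use inversions_le_length in blast)

lemma reflections_sym:
  assumes "t \<in> reflections (sym_group (n + 1)) (simple_transpositions n)"
  obtains a b where "1 \<le> a" "a < b" "b \<le> n + 1" "t = transpose a b"
proof -
  obtain w i where w: "w permutes {1..n + 1}" and i: "1 \<le> i" "i \<le> n"
    and "t = w \<otimes>\<^bsub>sym_group (n + 1)\<^esub> transpose i (i + 1) \<otimes>\<^bsub>sym_group (n + 1)\<^esub> inv\<^bsub>sym_group (n + 1)\<^esub> w"
    using assms by (auto simp: reflections_def simple_transpositions_def sym_group_carrier)
  then have t: "t = w \<circ> transpose i (i + 1) \<circ> Hilbert_Choice.inv w"
    by (simp add: sym_group_inv_equality sym_group_carrier) (simp add: sym_group_mult)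
  have "t = transpose (w i) (w (i + 1))"
  proof
    fix x
    have "x = w (Hilbert_Choice.inv w x)"
      using permutes_inverses(1) [OF w] by simp
    then show "t x = transpose (w i) (w (i + 1)) x"
      using transpose_apply_inj [OF permutes_inj [OF w], of i "i + 1" "Hilbert_Choice.inv w x"]
      unfolding t by simp
  qed
  moreover have "w i \<noteq> w (i + 1)"
    using permutes_inj [OF w] by (auto simp: inj_eq)
  moreover have "1 \<le> w i" "w i \<le> n + 1" "1 \<le> w (i + 1)" "w (i + 1) \<le> n + 1"
    using permutes_in_range [OF w, of i] permutes_in_range [OF w, of "i + 1"] i by auto
  ultimately show ?thesis
    using that [of "w i" "w (i + 1)"] that [of "w (i + 1)" "w i"]
    by (metis linorder_neqE_nat transpose_commute)
qed

lemma finite_coxeter_group_sym: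
  "finite_coxeter_group (sym_group (n + 1)) (simple_transpositions n)"
proof -
  interpret group "sym_group (n + 1)" by (rule sym_group_is_group)
  let ?len = "cox_length (sym_group (n + 1)) (simple_transpositions n)"
  show ?thesis
  proof
    show "finite (carrier (sym_group (n + 1)))"
      using finite_permutations [of "{1..n + 1}"] by (simp add: sym_group_def)
    show "simple_transpositions n \<subseteq> carrier (sym_group (n + 1))"
      using transpose_permutes by (auto simp: simple_transpositions_def sym_group_def)
    show "s \<otimes>\<^bsub>sym_group (n + 1)\<^esub> s = \<one>\<^bsub>sym_group (n + 1)\<^esub>" if "s \<in> simple_transpositions n" for s
      using that by (auto simp: simple_transpositions_def sym_group_def)
    show "\<exists>ws. set ws \<subseteq> simple_transpositions n \<and> word_prod (sym_group (n + 1)) ws = w"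
      if "w \<in> carrier (sym_group (n + 1))" for w
      using word_of_length_inversions [of w n] that unfolding sym_group_carrier by blast
    show "?len (w \<otimes>\<^bsub>sym_group (n + 1)\<^esub> s) \<noteq> ?len w"
      if w: "w \<in> carrier (sym_group (n + 1))" and s: "s \<in> simple_transpositions n" for w s
    proof -
      obtain i where i: "s = transpose i (i + 1)" "1 \<le> i" "i \<le> n"
        using s by (auto simp: simple_transpositions_def)
      have w': "w permutes {1..n + 1}" using w by (simp add: sym_group_carrier)
      have ws: "w \<circ> s permutes {1..n + 1}"
        using permutes_compose [OF transpose_permutes [OF i(2,3)] w'] i by simp
      have "w i \<noteq> w (i + 1)"
        using permutes_inj [OF w'] by (auto simp: inj_eq)
      then have "w i < w (i + 1) \<or> (w \<circ> s) i < (w \<circ> s) (i + 1)"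
        using i by auto
      then have "card (inversions (n + 1) w) < card (inversions (n + 1) (w \<circ> s)) \<or>
          card (inversions (n + 1) (w \<circ> s)) < card (inversions (n + 1) (w \<circ> s \<circ> s))"
        using i card_inversions_transpose [OF w', of i "i + 1"]
          card_inversions_transpose [OF ws, of i "i + 1"] by auto
      moreover have "w \<circ> s \<circ> s = w"
        using i by (simp add: comp_assoc)
      ultimately show ?thesis
        unfolding sym_group_mult cox_length_eq_inversions [OF w'] cox_length_eq_inversions [OF ws]
        by auto
    qed
    show "?len (x \<otimes>\<^bsub>sym_group (n + 1)\<^esub> s)
        < ?len (x \<otimes>\<^bsub>sym_group (n + 1)\<^esub> t \<otimes>\<^bsub>sym_group (n + 1)\<^esub> s)"
      if x: "x \<in> carrier (sym_group (n + 1))"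
        and t: "t \<in> reflections (sym_group (n + 1)) (simple_transpositions n)"
        and s: "s \<in> simple_transpositions n" and ts: "t \<noteq> s"
        and less: "?len x < ?len (x \<otimes>\<^bsub>sym_group (n + 1)\<^esub> t)" for x t s
    proof -
      obtain i where i: "s = transpose i (i + 1)" "1 \<le> i" "i \<le> n"
        using s by (auto simp: simple_transpositions_def)
      obtain a b where ab: "1 \<le> a" "a < b" "b \<le> n + 1" "t = transpose a b"
        using reflections_sym [OF t] by blast
      have x': "x permutes {1..n + 1}" using x by (simp add: sym_group_carrier)
      have t': "t permutes {1..n + 1}" using ab by (auto intro!: permutes_swap_id)
      have s': "s permutes {1..n + 1}" using i transpose_permutes by simp
      note xt = permutes_compose [OF t' x'] and xs = permutes_compose [OF s' x']
      note xts = permutes_compose [OF s' xt]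
      have "x a < x b"
        using less card_inversions_transpose_iff [OF x' ab(1-3)]
        unfolding sym_group_mult cox_length_eq_inversions [OF x']
          cox_length_eq_inversions [OF xt] unfolding ab(4) by blast
      \<comment> \<open>The only pair that s reverses is (i, i + 1), and (a, b) is a different pair
        because t differs from s. Hence x t s = (x s) (s a, s b) with the positions still in
        order.\<close>
      moreover have "s a < s b"
        using ab ts i by (auto simp: transpose_def split: if_splits)
      moreover have "(x \<circ> s) (s a) = x a" "(x \<circ> s) (s b) = x b"
        using i by auto
      moreover have "1 \<le> s a" "s b \<le> n + 1"
        using permutes_in_range [OF s', of a] permutes_in_range [OF s', of b] ab by auto
      ultimately have "card (inversions (n + 1) (x \<circ> s))
          < card (inversions (n + 1) (x \<circ> s \<circ> transpose (s a) (s b)))"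
        using xs by (intro card_inversions_transpose) auto
      also have "x \<circ> s \<circ> transpose (s a) (s b) = x \<circ> t \<circ> s"
      proof
        fix y
        have "transpose (s a) (s b) y = s (transpose a b (s y))"
          using transpose_apply_inj [OF permutes_inj [OF s'], of a b "s y"] i by simp
        then show "(x \<circ> s \<circ> transpose (s a) (s b)) y = (x \<circ> t \<circ> s) y"
          using ab i by simp
      qed
      finally show ?thesis
        unfolding sym_group_mult cox_length_eq_inversions [OF xs] cox_length_eq_inversions [OF xts] .
    qed
  qed
qed

context finite_coxeter_group
begin

lemma le_left_mult_right_cases:
  assumes "le x y" "s \<in> S"
  shows "le x (s \<otimes> y) \<or> le (s \<otimes> x) (s \<otimes> y)"
proof -
  have xy: "x \<in> carrier G" "y \<in> carrier G" using le_carrier assms by auto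
  have "le (inv x) (inv y \<otimes> s) \<or> le (inv x \<otimes> s) (inv y \<otimes> s)"
    using le_mult_right_cases [OF le_inv [OF assms(1)] assms(2)] .
  moreover have "inv y \<otimes> s = inv (s \<otimes> y)" "inv x \<otimes> s = inv (s \<otimes> x)"
    using xy assms(2) by (simp_all add: inv_mult_group)
  ultimately show ?thesis
    using le_inv_iff xy assms(2) by simp
qed

lemma le_left_mult_iff:
  assumes "w \<in> carrier G" "s \<in> S" "len w < len (s \<otimes> w)" "x \<in> carrier G"
  shows "le x (s \<otimes> w) \<longleftrightarrow> le x w \<or> le (s \<otimes> x) w"
proof -
  have "le (inv x) (inv w \<otimes> s) \<longleftrightarrow> le (inv x) (inv w) \<or> le (inv x \<otimes> s) (inv w)"
    using assms by (intro le_mult_iff) (simp_all add: len_left)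
  moreover have "inv w \<otimes> s = inv (s \<otimes> w)" "inv x \<otimes> s = inv (s \<otimes> x)"
    using assms by (simp_all add: inv_mult_group)
  ultimately show ?thesis
    using le_inv_iff assms by simp
qed

lemma le_left_mult_up: "\<lbrakk>y \<in> carrier G; s \<in> S; len y < len (s \<otimes> y)\<rbrakk> \<Longrightarrow> le y (s \<otimes> y)"
  using le_left_mult_iff [of y s y] le_refl by blast

lemma KL_column_flip:
  assumes "KL_column v c"
  shows "KL_column (inv v) (flip c)"
proof -
  have v: "v \<in> carrier G" and c: "selfdual (len v) c" "c v = 1"
    and nle: "\<And>u. \<not> le u v \<Longrightarrow> c u = 0"
    and deg: "\<And>u. \<lbrakk>le u v; u \<noteq> v\<rbrakk> \<Longrightarrow> 2 * degree (c u) + 1 \<le> len v - len u"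
    using assms by (auto simp: KL_column_def)
  have le: "le (inv u) v" if "le u (inv v)" for u
    using le_inv [OF that] v by simp
  have "2 * degree (flip c u) + 1 \<le> len v - len u" if "le u (inv v)" "u \<noteq> inv v" for u
  proof -
    have u: "u \<in> carrier G" using le_carrier that(1) by blast
    then have "inv u \<noteq> v" using that(2) by auto
    then show ?thesis using deg [OF le [OF that(1)]] u by (simp add: flip_def)
  qed
  moreover have "flip c u = 0" if "\<not> le u (inv v)" for u
  proof (cases "u \<in> carrier G")
    case True
    then have "\<not> le (inv u) v" using that le_inv [of "inv u" v] by auto
    then show ?thesis using nle by (simp add: flip_def)
  qed (simp add: flip_def)
  ultimately show ?thesis
    using v c selfdual_flip unfolding KL_column_def by (simp add: flip_def)
qed

end

section \<open>Boolean permutations\<close>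

declare sym_group_inv_equality [simp del]

text \<open>The size \<open>m = n + 1\<close> is a separate parameter because the simplifier would rewrite \<open>n + 1\<close>
  inside the group.\<close>

locale type_A =
  fixes n m :: nat
  assumes m_eq: "m = n + 1"

sublocale type_A \<subseteq> finite_coxeter_group "sym_group m" "simple_transpositions n"
  unfolding m_eq by (rule finite_coxeter_group_sym)

definition sw :: "nat \<Rightarrow> nat \<Rightarrow> nat" where
  "sw k = transpose k (Suc k)"

lemma sw_apply [simp]:
  "sw k k = Suc k" "sw k (Suc k) = k" "\<lbrakk>i \<noteq> k; i \<noteq> Suc k\<rbrakk> \<Longrightarrow> sw k i = i"
  by (auto simp: sw_def transpose_def)

lemma sw_sw [simp]: "sw k (sw k i) = i"
  by (simp add: sw_def)

lemma comp_sw_sw [simp]: "x \<circ> sw k \<circ> sw k = x" "sw k \<circ> (sw k \<circ> x) = x"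
  by (auto simp: fun_eq_iff)

lemma sw_image:
  assumes "1 \<le> k" "i \<noteq> k"
  shows "sw k ` {1..i} = {1..i}"
proof (cases "i < k")
  case True
  then have "sw k ` {1..i} = id ` {1..i}" by (intro image_cong) auto
  then show ?thesis by simp
next
  case False
  then have "sw k permutes {1..i}"
    using assms unfolding sw_def by (intro permutes_swap_id) auto
  then show ?thesis by (rule permutes_image)
qed

context type_A
begin

abbreviation W :: "(nat \<Rightarrow> nat) set" where "W \<equiv> carrier (sym_group m)"
abbreviation iv :: "(nat \<Rightarrow> nat) \<Rightarrow> nat \<Rightarrow> nat" where "iv x \<equiv> inv\<^bsub>sym_group m\<^esub> x"
abbreviation A :: "(nat \<Rightarrow> nat) \<Rightarrow> (nat \<Rightarrow> nat) \<Rightarrow> nat set" where "A \<equiv> A_set n"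

lemma m_ge_1: "1 \<le> m" and le_n_iff: "k \<le> n \<longleftrightarrow> Suc k \<le> m"
  by (simp_all add: m_eq)

lemmas W_iff = sym_group_carrier [of _ m]
lemmas comp_W [simp] = m_closed [unfolded sym_group_mult]
lemmas iv_comp = inv_mult_group [unfolded sym_group_mult]
lemmas le_right_iff = le_mult_iff [unfolded sym_group_mult]
lemmas le_left_iff = le_left_mult_iff [unfolded sym_group_mult]

lemma sw_S [simp]: "\<lbrakk>1 \<le> k; k \<le> n\<rbrakk> \<Longrightarrow> sw k \<in> simple_transpositions n"
  by (auto simp: simple_transpositions_def sw_def)

lemma sw_W [simp]: "\<lbrakk>1 \<le> k; k \<le> n\<rbrakk> \<Longrightarrow> sw k \<in> W"
  using sw_S by blast

lemma id_W [simp]: "id \<in> W"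
  using one_closed unfolding sym_group_one .

lemma iv_apply [simp]:
  assumes "x \<in> W"
  shows "iv x (x i) = i" "x (iv x i) = i"
proof -
  have "(iv x \<circ> x) i = i" "(x \<circ> iv x) i = i"
    using l_inv [OF assms] r_inv [OF assms] unfolding sym_group_mult sym_group_one by simp_all
  then show "iv x (x i) = i" "x (iv x i) = i" by simp_all
qed

lemma W_inj: "x \<in> W \<Longrightarrow> x i = x j \<longleftrightarrow> i = j"
  by (metis iv_apply(1))

lemma W_range: "\<lbrakk>x \<in> W; 1 \<le> i; i \<le> m\<rbrakk> \<Longrightarrow> 1 \<le> x i \<and> x i \<le> m"
  using permutes_in_range unfolding W_iff by blast

lemma len_sw_iff:
  assumes "x \<in> W" "1 \<le> k" "k \<le> n"
  shows "len x < len (x \<circ> sw k) \<longleftrightarrow> x k < x (Suc k)"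
proof -
  have x: "x permutes {1..n + 1}" using assms(1) unfolding W_iff unfolding m_eq .
  have "x \<circ> sw k \<in> W" using assms by simp
  then have xs: "x \<circ> sw k permutes {1..n + 1}" unfolding W_iff unfolding m_eq .
  show ?thesis
    using card_inversions_transpose_iff [OF x, of k "Suc k"] assms
    unfolding m_eq cox_length_eq_inversions [OF x] cox_length_eq_inversions [OF xs]
    by (simp add: sw_def)
qed

lemma len_sw_Suc:
  assumes "x \<in> W" "1 \<le> k" "k \<le> n" "x k < x (Suc k)"
  shows "len (x \<circ> sw k) = Suc (len x)"
  using len_mult_cases [of x "sw k", unfolded sym_group_mult] len_sw_iff assms by fastforce

text \<open>\<open>boolean_from k\<close> holds for the elements below the transposition \<open>(k, n + 1)\<close>; they are built
  from the elements below \<open>(k + 1, n + 1)\<close> by multiplying with \<open>sw k\<close> on either side.\<close>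

inductive boolean_from :: "nat \<Rightarrow> (nat \<Rightarrow> nat) \<Rightarrow> bool" where
  base: "boolean_from m id"
| keep: "\<lbrakk>boolean_from (Suc k) w; 1 \<le> k\<rbrakk> \<Longrightarrow> boolean_from k w"
| right: "\<lbrakk>boolean_from (Suc k) w; 1 \<le> k\<rbrakk> \<Longrightarrow> boolean_from k (w \<circ> sw k)"
| left: "\<lbrakk>boolean_from (Suc k) w; 1 \<le> k\<rbrakk> \<Longrightarrow> boolean_from k (sw k \<circ> w)"
| both: "\<lbrakk>boolean_from (Suc k) w; 1 \<le> k\<rbrakk> \<Longrightarrow> boolean_from k (sw k \<circ> w \<circ> sw k)"

lemma boolean_from_props:
  "boolean_from k w \<Longrightarrow> w \<in> W \<and> 1 \<le> k \<and> k \<le> m \<and> (\<forall>i<k. w i = i)"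
proof (induction rule: boolean_from.induct)
  case base
  have "id \<in> W \<and> 1 \<le> m \<and> m \<le> m \<and> (\<forall>i<m. id i = i)" using m_ge_1 by simp
  then show ?case .
next
  case (keep k w)
  then show ?case by simp
next
  case (right k w)
  then have "k \<le> n" using le_n_iff by simp
  then have "w \<circ> sw k \<in> W \<and> 1 \<le> k \<and> k \<le> m \<and> (\<forall>i<k. (w \<circ> sw k) i = i)"
    using right by simp
  then show ?case .
next
  case (left k w)
  then have "k \<le> n" using le_n_iff by simp
  then have "sw k \<circ> w \<in> W \<and> 1 \<le> k \<and> k \<le> m \<and> (\<forall>i<k. (sw k \<circ> w) i = i)"
    using left by simp
  then show ?case .
next
  case (both k w)
  then have "k \<le> n" using le_n_iff by simp
  then have "sw k \<circ> w \<circ> sw k \<in> W \<and> 1 \<le> k \<and> k \<le> m \<and> (\<forall>i<k. (sw k \<circ> w \<circ> sw k) i = i)"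
    using both by simp
  then show ?case .
qed

lemma boolean_fromD:
  assumes "boolean_from k w"
  shows "w \<in> W" "1 \<le> k" "k \<le> m" "i < k \<Longrightarrow> w i = i"
  using boolean_from_props [OF assms] by auto

lemma boolean_from_Suc_D:
  assumes "boolean_from (Suc k) w" "1 \<le> k"
  shows "w \<in> W" "k \<le> n" "w k = k" "k < w (Suc k)" "i \<le> k \<Longrightarrow> w i = i"
proof -
  note p = boolean_fromD [OF assms(1)]
  show "w \<in> W" "k \<le> n" "w k = k" "i \<le> k \<Longrightarrow> w i = i" using p le_n_iff by auto
  show "k < w (Suc k)"
  proof (rule ccontr)
    assume "\<not> k < w (Suc k)"
    then have "w (w (Suc k)) = w (Suc k)" using p by simp
    then have "w (Suc k) = Suc k" using W_inj p by blast
    then show False using \<open>\<not> k < w (Suc k)\<close> by simp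
  qed
qed

lemma boolean_from_inv: "boolean_from k w \<Longrightarrow> boolean_from k (iv w)"
proof (induction rule: boolean_from.induct)
  case base
  have "iv id = id" using inv_one unfolding sym_group_one .
  then have "boolean_from m (iv id)" by (simp only: boolean_from.base)
  then show ?case .
next
  case (keep k w)
  then show ?case by (blast intro: boolean_from.keep)
next
  case (right k w)
  then have "iv (w \<circ> sw k) = sw k \<circ> iv w"
    using boolean_from_Suc_D [OF right(1,2)] by (simp add: iv_comp)
  then have "boolean_from k (iv (w \<circ> sw k))"
    using boolean_from.left [OF right(3,2)] by (simp only:)
  then show ?case .
next
  case (left k w)
  then have "iv (sw k \<circ> w) = iv w \<circ> sw k"
    using boolean_from_Suc_D [OF left(1,2)] by (simp add: iv_comp)
  then have "boolean_from k (iv (sw k \<circ> w))"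
    using boolean_from.right [OF left(3,2)] by (simp only:)
  then show ?case .
next
  case (both k w)
  then have "iv (sw k \<circ> w \<circ> sw k) = sw k \<circ> iv w \<circ> sw k"
    using boolean_from_Suc_D [OF both(1,2)] by (simp add: iv_comp comp_assoc)
  then have "boolean_from k (iv (sw k \<circ> w \<circ> sw k))"
    using boolean_from.both [OF both(3,2)] by (simp only:)
  then show ?case .
qed

lemma le_comp_sw_cases:
  assumes "le x (w \<circ> sw k)" "w \<in> W" "1 \<le> k" "k \<le> n"
  shows "le x w \<or> le (x \<circ> sw k) w"
  using le_mult_right_cases [OF assms(1) sw_S [OF assms(3,4)], unfolded sym_group_mult] assms by simp

lemma le_sw_comp_cases:
  assumes "le x (sw k \<circ> w)" "w \<in> W" "1 \<le> k" "k \<le> n"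
  shows "le x w \<or> le (sw k \<circ> x) w"
  using le_left_mult_right_cases [OF assms(1) sw_S [OF assms(3,4)], unfolded sym_group_mult] assms by simp

text \<open>An element below w s is below w or becomes so after multiplication by s, and each
  outcome matches a constructor. For \<open>both\<close> the right factor is removed first; the
  auxiliary claim for s w therefore treats y and y s together.\<close>

lemma boolean_from_le: "\<lbrakk>boolean_from k w; le x w\<rbrakk> \<Longrightarrow> boolean_from k x"
proof (induction arbitrary: x rule: boolean_from.induct)
  case base
  then have "le x id" by (simp only: id_def)
  then have "x = id" using le_one_iff unfolding sym_group_one by blast
  then show ?case using boolean_from.base by blast
next
  case (keep k w)
  then show ?case by (blast intro: boolean_from.keep)
next
  case (right k w)
  have "le x (w \<circ> sw k)" using right(4) .
  then have "le x w \<or> le (x \<circ> sw k) w"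
    using boolean_from_Suc_D [OF right(1,2)] right(2) by (intro le_comp_sw_cases)
  then show ?case
    using right(2,3) boolean_from.keep boolean_from.right [of k "x \<circ> sw k"] by auto
next
  case (left k w)
  have "le x (sw k \<circ> w)" using left(4) .
  then have "le x w \<or> le (sw k \<circ> x) w"
    using boolean_from_Suc_D [OF left(1,2)] left(2) by (intro le_sw_comp_cases)
  then show ?case
    using left(2,3) boolean_from.keep boolean_from.left [of k "sw k \<circ> x"] by auto
next
  case (both k w)
  note p = boolean_from_Suc_D [OF both(1,2)]
  have *: "boolean_from k y \<and> boolean_from k (y \<circ> sw k)" if "le y (sw k \<circ> w)" for y
  proof -
    have "le y w \<or> le (sw k \<circ> y) w"
      using that p both(2) by (intro le_sw_comp_cases)
    then show ?thesis
    proof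
      assume "le y w"
      then show ?thesis using both(2,3) boolean_from.keep boolean_from.right by blast
    next
      assume "le (sw k \<circ> y) w"
      then have "boolean_from (Suc k) (sw k \<circ> y)" using both(3) by blast
      then show ?thesis
        using boolean_from.left [of k "sw k \<circ> y"] boolean_from.both [of k "sw k \<circ> y"] both(2)
        by simp
    qed
  qed
  have "le x (sw k \<circ> w \<circ> sw k)" using both(4) .
  moreover have "sw k \<circ> w \<in> W" using p both(2) by simp
  ultimately have "le x (sw k \<circ> w) \<or> le (x \<circ> sw k) (sw k \<circ> w)"
    using both(2) p by (intro le_comp_sw_cases)
  then show ?case
  proof
    assume "le (x \<circ> sw k) (sw k \<circ> w)"
    then show ?thesis using * [of "x \<circ> sw k"] by simp
  qed (use * in blast)
qed

lemma boolean_from_antimono: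
  assumes "boolean_from k w" "1 \<le> j" "j \<le> k"
  shows "boolean_from j w"
  using assms(3)
proof (induction rule: inc_induct)
  case (step i)
  show ?case using step.IH by (rule boolean_from.keep) (use step assms(2) in simp)
qed (rule assms(1))

lemma boolean_from_id: "\<lbrakk>1 \<le> k; k \<le> m\<rbrakk> \<Longrightarrow> boolean_from k id"
  using boolean_from_antimono boolean_from.base by blast

text \<open>The identity (a, b) = s_a (a+1, b) s_a makes each transposition a \<open>both\<close>
  step over the next shorter one.\<close>

lemma boolean_from_transpose: "\<lbrakk>1 \<le> a; a < b; b \<le> m\<rbrakk> \<Longrightarrow> boolean_from a (transpose a b)"
proof (induction "b - a" arbitrary: a)
  case (Suc d)
  show ?case
  proof (cases "b = Suc a")
    case True
    then show ?thesis
      using boolean_from.right [of a id] boolean_from_id [of "Suc a"] Suc.prems by (simp add: sw_def)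
  next
    case False
    then have "boolean_from (Suc a) (transpose (Suc a) b)"
      using Suc by auto
    then have "boolean_from a (sw a \<circ> transpose (Suc a) b \<circ> sw a)"
      using Suc.prems boolean_from.both by blast
    also have "sw a \<circ> transpose (Suc a) b \<circ> sw a = transpose a b"
      using False Suc.prems by (auto simp: fun_eq_iff sw_def transpose_def)
    finally show ?thesis .
  qed
qed simp

text \<open>The reflection above w is a transposition (a, b), which is generated from level a;
  \<open>boolean_from_le\<close> passes this down to w.\<close>

lemma boolean_element_imp_boolean_from:
  assumes "boolean_element (sym_group m) (simple_transpositions n) w"
  shows "boolean_from 1 w"
proof -
  obtain t where t: "t \<in> reflections (sym_group m) (simple_transpositions n)" "le w t"
    using assms by (auto simp: boolean_element_def boolean_reflection_def)
  then obtain a b where ab: "1 \<le> a" "a < b" "b \<le> n + 1" "t = transpose a b"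
    using reflections_sym unfolding m_eq by blast
  then have "boolean_from a w"
    using boolean_from_transpose [of a b] boolean_from_le t m_eq by blast
  then show ?thesis using boolean_from_antimono ab by blast
qed

section \<open>The sets Fix, NFix and A under multiplication by s_k\<close>

lemma Fix_comp_sw:
  assumes "1 \<le> k" "i \<noteq> k"
  shows "i \<in> Fix n (x \<circ> sw k) \<longleftrightarrow> i \<in> Fix n x" "i \<in> Fix n (sw k \<circ> x) \<longleftrightarrow> i \<in> Fix n x"
proof -
  note s = sw_image [OF assms]
  show "i \<in> Fix n (x \<circ> sw k) \<longleftrightarrow> i \<in> Fix n x"
    unfolding Fix_def mem_Collect_eq image_comp [symmetric] s ..
  have *: "sw k ` (x ` {1..i}) = {1..i} \<longleftrightarrow> x ` {1..i} = {1..i}"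
  proof
    assume "sw k ` (x ` {1..i}) = {1..i}"
    then have "sw k ` (sw k ` (x ` {1..i})) = {1..i}" using s by metis
    then show "x ` {1..i} = {1..i}" by (simp add: image_image)
  qed (metis s)
  show "i \<in> Fix n (sw k \<circ> x) \<longleftrightarrow> i \<in> Fix n x"
    unfolding Fix_def mem_Collect_eq image_comp [symmetric] * ..
qed

lemma Fix_iv:
  assumes "x \<in> W"
  shows "Fix n (iv x) = Fix n x"
proof -
  have "iv x ` X = X \<longleftrightarrow> x ` X = X" for X
  proof -
    have "x ` (iv x ` X) = X" "iv x ` (x ` X) = X"
      using assms by (auto simp: image_image)
    then show ?thesis by metis
  qed
  then show ?thesis by (simp add: Fix_def)
qed

lemma NFix_iv:
  assumes "x \<in> W"
  shows "NFix n (iv x) = NFix n x"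
proof -
  have "iv x i = i \<longleftrightarrow> x i = i" for i
    using assms by (metis iv_apply)
  then show ?thesis using assms by (simp add: NFix_def Fix_iv)
qed

lemma A_iv: "\<lbrakk>x \<in> W; w \<in> W\<rbrakk> \<Longrightarrow> A (iv x) (iv w) = A x w"
  by (simp add: A_set_def Fix_iv NFix_iv)

lemma A_self [simp]: "A w w = {}"
  by (auto simp: A_set_def NFix_def)

lemma finite_A [simp]: "finite (A x w)"
  by (simp add: A_set_def)

lemma A_cong: "NFix n v = NFix n w \<Longrightarrow> A x v = A x w"
  by (simp add: A_set_def)

lemma mem_Fix_if_fixes: "\<lbrakk>1 \<le> i; i \<le> n; \<And>j. j \<le> i \<Longrightarrow> w j = j\<rbrakk> \<Longrightarrow> i \<in> Fix n w"
  by (auto simp: Fix_def image_def)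

lemma NFix_gt: "\<lbrakk>boolean_from (Suc k) w; i \<in> NFix n w\<rbrakk> \<Longrightarrow> k < i"
  using mem_Fix_if_fixes [of i w] boolean_fromD(4) by (force simp: NFix_def)

text \<open>\<open>A x w\<close> consults Fix(x) only at i + 1 with i in NFix(w), hence with i > k,
  and s_k preserves each set {1..j} with j > k.\<close>

lemma A_comp_sw:
  assumes "boolean_from (Suc k) w" "1 \<le> k"
  shows "A (x \<circ> sw k) w = A x w" "A (sw k \<circ> x) w = A x w"
proof -
  have "i + 1 \<in> Fix n (x \<circ> sw k) \<longleftrightarrow> i + 1 \<in> Fix n x"
    "i + 1 \<in> Fix n (sw k \<circ> x) \<longleftrightarrow> i + 1 \<in> Fix n x" if "i \<in> NFix n w" for i
    using NFix_gt [OF assms(1) that] assms(2) by (simp_all add: Fix_comp_sw)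
  then show "A (x \<circ> sw k) w = A x w" "A (sw k \<circ> x) w = A x w"
    unfolding A_set_def by blast+
qed

text \<open>The one critical position is k: the product may leave Fix there, but it sends k + 1 to
  w(k) = k, so k does not enter NFix. Above k neither condition changes.\<close>

lemma NFix_comp_sw:
  assumes "boolean_from (Suc k) w" "1 \<le> k"
  shows "NFix n (w \<circ> sw k) = NFix n w"
proof -
  note p = boolean_from_Suc_D [OF assms]
  have "i \<in> NFix n (w \<circ> sw k) \<longleftrightarrow> i \<in> NFix n w" for i
  proof -
    consider "i < k" | "i = k" | "k < i" by linarith
    then show ?thesis
    proof cases
      case 1
      have "boolean_from k (w \<circ> sw k)" using assms boolean_from.right by blast
      then have "i \<notin> NFix n (w \<circ> sw k)"
        using mem_Fix_if_fixes [of i "w \<circ> sw k"] boolean_fromD(4) 1 by (force simp: NFix_def)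
      then show ?thesis using NFix_gt [OF assms(1)] 1 by force
    next
      case 2
      then show ?thesis using NFix_gt [OF assms(1), of i] p by (auto simp: NFix_def)
    next
      case 3
      then show ?thesis using assms by (simp add: NFix_def Fix_comp_sw)
    qed
  qed
  then show ?thesis by blast
qed

lemma NFix_sw_comp:
  assumes "boolean_from (Suc k) w" "1 \<le> k"
  shows "NFix n (sw k \<circ> w) = NFix n w"
proof -
  note p = boolean_from_Suc_D [OF assms]
  have "iv (sw k \<circ> w) = iv w \<circ> sw k" using p assms by (simp add: iv_comp)
  then have "NFix n (iv (sw k \<circ> w)) = NFix n (iv w)"
    using NFix_comp_sw [OF boolean_from_inv [OF assms(1)] assms(2)] by simp
  then show ?thesis using NFix_iv p assms by simp
qed

section \<open>The candidate columns and their one-sided products\<close>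

definition col :: "(nat \<Rightarrow> nat) \<Rightarrow> (nat \<Rightarrow> nat) \<Rightarrow> int poly" where
  "col v u = (if le u v then (1 + q) ^ card (A u v) else 0)"

lemma degree_one_plus_q_power: "degree ((1 + q) ^ k) = k"
proof -
  have "1 + q = [:1, 1:]" by (simp add: q_def one_pCons)
  then show ?thesis by (simp add: degree_power_eq)
qed

lemma KL_column_colI:
  assumes "v \<in> W" "selfdual (len v) (col v)"
    and "\<And>u. \<lbrakk>le u v; u \<noteq> v\<rbrakk> \<Longrightarrow> 2 * card (A u v) + 1 + len u \<le> len v"
  shows "KL_column v (col v)"
proof -
  have "2 * degree (col v u) + 1 \<le> len v - len u" if "le u v" "u \<noteq> v" for u
    using assms(3) [OF that] that by (simp add: col_def degree_one_plus_q_power)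
  then show ?thesis
    using assms(1,2) by (auto simp: KL_column_def col_def)
qed

lemma KL_column_colD:
  assumes "KL_column v (col v)"
  shows "v \<in> W" "selfdual (len v) (col v)"
    "\<lbrakk>le u v; u \<noteq> v\<rbrakk> \<Longrightarrow> 2 * card (A u v) + 1 + len u \<le> len v"
proof -
  show "v \<in> W" "selfdual (len v) (col v)" using assms by (auto simp: KL_column_def)
  assume u: "le u v" "u \<noteq> v"
  then have "2 * degree (col v u) + 1 \<le> len v - len u"
    using assms by (auto simp: KL_column_def)
  then show "2 * card (A u v) + 1 + len u \<le> len v"
    using u le_len by (fastforce simp: col_def degree_one_plus_q_power)
qed

lemma KL_column_col_iv:
  assumes "KL_column v (col v)"
  shows "KL_column (iv v) (col (iv v))"
proof -
  have v: "v \<in> W" using KL_column_colD assms by blast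
  have "flip (col v) = col (iv v)"
  proof
    fix u
    show "flip (col v) u = col (iv v) u"
    proof (cases "u \<in> W")
      case True
      then have "le (iv u) v \<longleftrightarrow> le u (iv v)"
        using le_inv_iff [of u "iv v"] v by simp
      moreover have "A (iv u) v = A u (iv v)"
        using A_iv [of u "iv v"] True v by simp
      ultimately show ?thesis using True by (simp add: flip_def col_def)
    next
      case False
      then have "\<not> le u (iv v)" using le_carrier by blast
      then show ?thesis using False by (simp add: flip_def col_def)
    qed
  qed
  then show ?thesis using KL_column_flip [OF assms] by simp
qed

text \<open>Everything below w fixes k, whereas multiplication by s_k on either side destroys this.
  Hence the lower interval of w is disjoint from its translates, and at most one summand of T_s + 1
  is nonzero at each element.\<close>

lemma boolean_from_Suc_le_disjoint:
  assumes "boolean_from (Suc k) w" "1 \<le> k" "le u w"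
  shows "\<not> le (u \<circ> sw k) w" "\<not> le (sw k \<circ> u) w" "u k < u (Suc k)"
proof -
  note p = boolean_from_Suc_D [OF boolean_from_le [OF assms(1,3)] assms(2)]
  show "u k < u (Suc k)" using p by simp
  show "\<not> le (u \<circ> sw k) w"
  proof
    assume "le (u \<circ> sw k) w"
    from boolean_from_Suc_D(3) [OF boolean_from_le [OF assms(1) this] assms(2)] p
    show False by simp
  qed
  show "\<not> le (sw k \<circ> u) w"
  proof
    assume "le (sw k \<circ> u) w"
    from boolean_from_Suc_D(3) [OF boolean_from_le [OF assms(1) this] assms(2)] p
    show False by simp
  qed
qed

text \<open>The lower interval of w s is the disjoint union of that of w and its translate by s, and
  A does not distinguish u from u s. So one multiplication by T_s + 1 gives exactly the candidate,
  and the degree bound moves up by one length unit.\<close>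

lemma KL_column_col_right:
  assumes w: "boolean_from (Suc k) w" "1 \<le> k" and KL: "KL_column w (col w)"
  shows "KL_column (w \<circ> sw k) (col (w \<circ> sw k))"
proof -
  let ?s = "sw k"
  note p = boolean_from_Suc_D [OF w]
  note D = KL_column_colD [OF KL]
  have s: "?s \<in> simple_transpositions n" using p w by simp
  have len: "len (w \<circ> ?s) = Suc (len w)"
    using p w by (intro len_sw_Suc) auto
  have le_iff: "le u (w \<circ> ?s) \<longleftrightarrow> le u w \<or> le (u \<circ> ?s) w" if "u \<in> W" for u
    using that p s len by (intro le_right_iff) auto
  have A: "A u (w \<circ> ?s) = A u w" "A (u \<circ> ?s) w = A u w" for u
    using A_cong [OF NFix_comp_sw [OF w]] A_comp_sw [OF w] by auto
  have eq: "col (w \<circ> ?s) = (\<lambda>u. T ?s (col w) u + col w u)"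
  proof
    fix u
    show "col (w \<circ> ?s) u = T ?s (col w) u + col w u"
    proof (cases "u \<in> W")
      case u: True
      have T: "T ?s (col w) u + col w u =
          (if len (u \<circ> ?s) < len u then col w (u \<circ> ?s) + q * col w u
           else q * col w (u \<circ> ?s) + col w u)"
        using u by (simp add: T_def sym_group_mult algebra_simps)
      consider "le u w" | "le (u \<circ> ?s) w" | "\<not> le u w" "\<not> le (u \<circ> ?s) w" by blast
      then show ?thesis
      proof cases
        case 1
        then have "\<not> le (u \<circ> ?s) w" "len u < len (u \<circ> ?s)"
          using boolean_from_Suc_le_disjoint [OF w 1] len_sw_iff [OF u] w p by auto
        then show ?thesis using 1 u unfolding T by (simp add: col_def le_iff A)
      next
        case 2
        have us: "u \<circ> ?s \<in> W" using u s by simp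
        have "\<not> le u w" "len (u \<circ> ?s) < len u"
          using boolean_from_Suc_le_disjoint [OF w 2] len_sw_iff [OF us w(2) p(2)] by auto
        then show ?thesis using 2 u unfolding T by (simp add: col_def le_iff A)
      next
        case 3
        then show ?thesis using u unfolding T by (simp add: col_def le_iff)
      qed
    next
      case False
      then have "\<not> le u (w \<circ> ?s)" "\<not> le u w" using le_carrier by blast+
      then show ?thesis using False by (simp add: col_def T_def)
    qed
  qed
  show ?thesis
  proof (rule KL_column_colI)
    show "w \<circ> ?s \<in> W" using p s by simp
    show "selfdual (len (w \<circ> ?s)) (col (w \<circ> ?s))"
      unfolding eq len using selfdual_T [OF D(2) s] .
    fix u assume u: "le u (w \<circ> ?s)" "u \<noteq> w \<circ> ?s"
    then have uW: "u \<in> W" using le_carrier by blast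
    have "u \<circ> ?s \<noteq> w" using u(2) by auto
    with uW consider "u = w" | "le u w" "u \<noteq> w" | "le (u \<circ> ?s) w" "u \<circ> ?s \<noteq> w"
      using le_iff u by auto
    then show "2 * card (A u (w \<circ> ?s)) + 1 + len u \<le> len (w \<circ> ?s)"
    proof cases
      case 1
      then show ?thesis by (simp add: A len)
    next
      case 2
      then show ?thesis using D(3) [of u] by (simp add: A len)
    next
      case 3
      have "len u \<le> Suc (len (u \<circ> ?s))"
        using len_mult_le [of "u \<circ> ?s" ?s, unfolded sym_group_mult] uW s by simp
      then show ?thesis using D(3) [of "u \<circ> ?s"] 3 by (simp add: A len)
    qed
  qed
qed

lemma KL_column_col_left:
  assumes w: "boolean_from (Suc k) w" "1 \<le> k" and KL: "KL_column w (col w)"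
  shows "KL_column (sw k \<circ> w) (col (sw k \<circ> w))"
proof -
  note p = boolean_from_Suc_D [OF w]
  have "iv (iv w \<circ> sw k) = sw k \<circ> w"
    using p w by (simp add: iv_comp)
  then show ?thesis
    using KL_column_col_iv [OF KL_column_col_right
        [OF boolean_from_inv [OF w(1)] w(2) KL_column_col_iv [OF KL]]] by simp
qed

end

section \<open>Two-sided multiplication by a generator\<close>

lemma (in finite_coxeter_group) selfdual_LT:
  assumes "selfdual l f" "s \<in> S"
  shows "selfdual (Suc l) (\<lambda>u. LT s f u + f u)"
proof -
  have f: "supported f" using assms by (simp add: selfdual_def)
  have "flip (\<lambda>u. T s (flip f) u + flip f u) = (\<lambda>u. LT s f u + f u)"
    using f by (auto simp: LT_def flip_def supported_def fun_eq_iff)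
  then show ?thesis
    using selfdual_flip [OF selfdual_T [OF selfdual_flip [OF assms(1)] assms(2)]] by simp
qed

context type_A
begin

lemma mem_Fix_Suc_iff:
  assumes "boolean_from (Suc k) x" "Suc k \<le> n"
  shows "Suc k \<in> Fix n x \<longleftrightarrow> x (Suc k) = Suc k"
proof -
  have "x ` {1..k} = id ` {1..k}"
    using boolean_fromD(4) [OF assms(1)] by (intro image_cong) auto
  then have "x ` {1..Suc k} = insert (x (Suc k)) {1..k}"
    by (simp add: atLeastAtMostSuc_conv)
  moreover have "{1..Suc k} = insert (Suc k) {1..k}" by auto
  moreover have "Suc k \<notin> {1..k}" by simp
  ultimately have "x ` {1..Suc k} = {1..Suc k} \<longleftrightarrow> x (Suc k) = Suc k"
    by (metis insertE insertI1)
  then show ?thesis using assms(2) by (simp add: Fix_def)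
qed

lemma sw_comp_commute:
  assumes "x \<in> W" "x k = k" "x (Suc k) = Suc k"
  shows "sw k \<circ> x = x \<circ> sw k"
proof
  fix i
  consider "i = k" | "i = Suc k" | "i \<noteq> k" "i \<noteq> Suc k" by blast
  then show "(sw k \<circ> x) i = (x \<circ> sw k) i"
  proof cases
    case 3
    then have "x i \<noteq> k" "x i \<noteq> Suc k" using assms W_inj by metis+
    then show ?thesis using 3 by simp
  qed (use assms in simp_all)
qed

section \<open>The product s_k w s_k for w moving k + 1\<close>

context
  fixes k w
  assumes w: "boolean_from (Suc k) w" and k: "1 \<le> k" and moves: "w (Suc k) \<noteq> Suc k"
begin

lemma both_basic:
  shows "w \<in> W" "k \<le> n" "w k = k" "Suc k < w (Suc k)" "Suc k \<le> n"
    "w \<circ> sw k \<in> W" "sw k \<circ> w \<circ> sw k \<in> W" "len (w \<circ> sw k) = Suc (len w)"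
    "len (sw k \<circ> (w \<circ> sw k)) = Suc (len (w \<circ> sw k))"
proof -
  note p = boolean_from_Suc_D [OF w k]
  show 1: "w \<in> W" "k \<le> n" "w k = k" using p by auto
  show 2: "Suc k < w (Suc k)" using p moves by linarith
  have "w (Suc k) \<le> m" using W_range [OF 1(1), of "Suc k"] le_n_iff 1(2) by auto
  then show "Suc k \<le> n" using 2 le_n_iff by simp
  show 3: "w \<circ> sw k \<in> W" "sw k \<circ> w \<circ> sw k \<in> W" using 1 k by auto
  show 4: "len (w \<circ> sw k) = Suc (len w)" using p k by (intro len_sw_Suc) auto
  note p' = boolean_from_Suc_D [OF boolean_from_inv [OF w] k]
  have "len (sw k \<circ> w) = len (iv w \<circ> sw k)"
    using len_left [OF 1(1) sw_S [OF k 1(2)], unfolded sym_group_mult] .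
  also have "\<dots> = Suc (len w)"
    using p' k 1 len_sw_Suc [of "iv w" k] by simp
  finally have l: "len (sw k \<circ> w) = Suc (len w)" .
  have "len (sw k \<circ> w \<circ> sw k) = Suc (len (sw k \<circ> w))"
    using 1 2 k by (intro len_sw_Suc) auto
  then show "len (sw k \<circ> (w \<circ> sw k)) = Suc (len (w \<circ> sw k))"
    using l 4 by (simp only: comp_assoc)
qed

lemma le_comp_sw_iff: "u \<in> W \<Longrightarrow> le u (w \<circ> sw k) \<longleftrightarrow> le u w \<or> le (u \<circ> sw k) w"
  using both_basic k by (intro le_right_iff) auto

lemma le_both_iff:
  "u \<in> W \<Longrightarrow> le u (sw k \<circ> w \<circ> sw k) \<longleftrightarrow> le u (w \<circ> sw k) \<or> le (sw k \<circ> u) (w \<circ> sw k)"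
  unfolding comp_assoc using both_basic k by (intro le_left_iff) auto

lemma le_comp_sw_E:
  assumes "le u (w \<circ> sw k)"
  obtains x where "le x w" "u = x \<or> u = x \<circ> sw k"
proof -
  have "u \<in> W" using le_carrier assms by blast
  then have "le u w \<or> le (u \<circ> sw k) w" using assms le_comp_sw_iff by blast
  then show ?thesis using that [of u] that [of "u \<circ> sw k"] by auto
qed

text \<open>Write u as x or x s with x below w. If x fixes k + 1, then s commutes with x and s u has
  the same form. Conversely, s u can only be below w s if s x s is below w; then s x s fixes k, so x
  fixes k + 1. This describes the overlap that creates the factor 1+q.\<close>

lemma le_comp_sw_fix:
  assumes "le u (w \<circ> sw k)"
  shows "le (sw k \<circ> u) (w \<circ> sw k) \<longleftrightarrow> Suc k \<in> Fix n u"
proof -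
  obtain x where x: "le x w" "u = x \<or> u = x \<circ> sw k"
    using le_comp_sw_E assms by blast
  note bx = boolean_from_le [OF w x(1)]
  note px = boolean_from_Suc_D [OF bx k]
  note b = both_basic
  have u: "u \<in> W" "sw k \<circ> u \<in> W" using px x k by auto
  have "Suc k \<in> Fix n u \<longleftrightarrow> Suc k \<in> Fix n x"
    using x Fix_comp_sw [OF k, of "Suc k" x] by auto
  then have fix_iff: "Suc k \<in> Fix n u \<longleftrightarrow> x (Suc k) = Suc k"
    using mem_Fix_Suc_iff [OF bx b(5)] by simp
  show ?thesis
  proof
    assume "Suc k \<in> Fix n u"
    then have c: "sw k \<circ> x = x \<circ> sw k"
      using sw_comp_commute px fix_iff by blast
    have "sw k \<circ> u = x \<circ> sw k \<or> sw k \<circ> u = x"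
      using x(2) c by (metis comp_assoc comp_sw_sw(1))
    moreover have "x \<circ> sw k \<circ> sw k = x" by simp
    ultimately show "le (sw k \<circ> u) (w \<circ> sw k)"
      using le_comp_sw_iff [OF u(2)] x(1) by metis
  next
    assume "le (sw k \<circ> u) (w \<circ> sw k)"
    then have "le (sw k \<circ> u) w \<or> le (sw k \<circ> u \<circ> sw k) w"
      using le_comp_sw_iff u by blast
    moreover have "\<not> le (sw k \<circ> x) w"
      using boolean_from_Suc_le_disjoint(2) [OF w k x(1)] .
    moreover have "sw k \<circ> (x \<circ> sw k) = sw k \<circ> x \<circ> sw k" "sw k \<circ> (x \<circ> sw k) \<circ> sw k = sw k \<circ> x"
      by (auto simp: fun_eq_iff)
    ultimately have "le (sw k \<circ> x \<circ> sw k) w"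
      using x(2) by auto
    from boolean_from_Suc_D(3) [OF boolean_from_le [OF w this] k]
    have "sw k (x (Suc k)) = k" by simp
    then have "x (Suc k) = Suc k" by (metis sw_apply(1) sw_sw)
    then show "Suc k \<in> Fix n u" using fix_iff by simp
  qed
qed

lemma le_comp_sw_ascent:
  assumes "le u (w \<circ> sw k)" "\<not> le (sw k \<circ> u) (w \<circ> sw k)"
  shows "len u < len (sw k \<circ> u)"
proof (rule ccontr)
  assume less: "\<not> len u < len (sw k \<circ> u)"
  have u: "u \<in> W" using le_carrier assms by blast
  have s: "sw k \<in> simple_transpositions n" using k both_basic by simp
  have "len (sw k \<circ> u) < len (sw k \<circ> (sw k \<circ> u))"
    using len_left_cases [OF u s, unfolded sym_group_mult] less by auto
  then have "le (sw k \<circ> u) (sw k \<circ> (sw k \<circ> u))"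
    using le_left_mult_up [of "sw k \<circ> u" "sw k", unfolded sym_group_mult] u s by simp
  then show False using assms le_trans by simp
qed

lemma A_comp_sw_both:
  "A u (w \<circ> sw k) = A u w" "A (sw k \<circ> u) w = A u w" "A (u \<circ> sw k) w = A u w"
  using A_cong [OF NFix_comp_sw [OF w k]] A_comp_sw [OF w k] by auto

text \<open>On the overlap both summands are present and A agrees on u and s u, so their sum is 1+q
  times the common value whichever of the two is longer. Elsewhere the ascent from
  \<open>le_comp_sw_ascent\<close> leaves one summand, with coefficient 1.\<close>

lemma LT_col:
  assumes u: "u \<in> W"
  shows "LT (sw k) (col (w \<circ> sw k)) u + col (w \<circ> sw k) u =
    (if le u (sw k \<circ> w \<circ> sw k)
     then (1 + q) ^ (card (A u w) + (if Suc k \<in> Fix n u then 1 else 0)) else 0)"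
proof -
  let ?s = "sw k" and ?c = "col (w \<circ> sw k)"
  have s: "?s \<in> simple_transpositions n" "?s \<circ> u \<in> W" using k both_basic u by auto
  have LT: "LT ?s ?c u + ?c u =
      (if len (?s \<circ> u) < len u then ?c (?s \<circ> u) + q * ?c u else q * ?c (?s \<circ> u) + ?c u)"
    using LT_eq [OF s(1) u, of ?c] by (simp add: sym_group_mult algebra_simps)
  have fix_s: "Suc k \<in> Fix n (?s \<circ> u) \<longleftrightarrow> Suc k \<in> Fix n u"
    using Fix_comp_sw [OF k, of "Suc k" u] by simp
  consider "le u (w \<circ> ?s)" "le (?s \<circ> u) (w \<circ> ?s)" | "le u (w \<circ> ?s)" "\<not> le (?s \<circ> u) (w \<circ> ?s)"
    | "\<not> le u (w \<circ> ?s)" "le (?s \<circ> u) (w \<circ> ?s)" | "\<not> le u (w \<circ> ?s)" "\<not> le (?s \<circ> u) (w \<circ> ?s)"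
    by blast
  then show ?thesis
  proof cases
    case 1
    then have "Suc k \<in> Fix n u" using le_comp_sw_fix by blast
    then show ?thesis
      using 1 u unfolding LT
      by (simp add: col_def le_both_iff A_comp_sw_both algebra_simps)
  next
    case 2
    then have "Suc k \<notin> Fix n u" "len u < len (?s \<circ> u)"
      using le_comp_sw_fix le_comp_sw_ascent by blast+
    then show ?thesis
      using 2 u unfolding LT by (simp add: col_def le_both_iff A_comp_sw_both)
  next
    case 3
    then have "Suc k \<notin> Fix n u" "len (?s \<circ> u) < len u"
      using le_comp_sw_fix [OF 3(2)] le_comp_sw_ascent [OF 3(2)] fix_s by auto
    then show ?thesis
      using 3 u unfolding LT by (simp add: col_def le_both_iff A_comp_sw_both)
  next
    case 4
    then show ?thesis
      using u unfolding LT by (simp add: col_def le_both_iff)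
  qed
qed

text \<open>The product sends k + 1 to itself and k to w(k + 1) > k, so {1..k} is not preserved and
  k becomes a member of NFix.\<close>

lemma NFix_both: "NFix n (sw k \<circ> w \<circ> sw k) = insert k (NFix n w)"
proof -
  let ?v = "sw k \<circ> w \<circ> sw k"
  note b = both_basic
  have bv: "boolean_from k ?v" using boolean_from.both [OF w k] .
  have "i \<in> NFix n ?v \<longleftrightarrow> i = k \<or> i \<in> NFix n w" for i
  proof -
    consider "i < k" | "i = k" | "k < i" by linarith
    then show ?thesis
    proof cases
      case 1
      then have "i \<notin> NFix n ?v"
        using mem_Fix_if_fixes [of i ?v] boolean_fromD(4) [OF bv] by (force simp: NFix_def)
      then show ?thesis using NFix_gt [OF w, of i] 1 by auto
    next
      case 2
      have vk: "?v k = w (Suc k)" "?v (Suc k) = Suc k" using b by auto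
      have "k \<notin> Fix n ?v"
      proof
        assume "k \<in> Fix n ?v"
        then have "?v ` {1..k} = {1..k}" unfolding Fix_def mem_Collect_eq by (rule conjunct2)
        moreover have "?v k \<in> ?v ` {1..k}" using k by (intro imageI) simp
        ultimately have "?v k \<le> k" by (metis atLeastAtMost_iff)
        then show False using vk(1) b(4) by linarith
      qed
      then show ?thesis using 2 vk(2) b(2) k by (simp add: NFix_def)
    next
      case 3
      have "sw k (w (Suc i)) = Suc i \<longleftrightarrow> w (Suc i) = Suc i"
        using 3 by (metis sw_apply(3) sw_sw less_irrefl Suc_inject less_SucI)
      then have "?v (i + 1) = i + 1 \<longleftrightarrow> w (i + 1) = i + 1" using 3 by simp
      moreover have "i \<in> Fix n ?v \<longleftrightarrow> i \<in> Fix n w"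
        using 3 k Fix_comp_sw [of k i "sw k \<circ> w"] Fix_comp_sw [of k i w] by simp
      ultimately show ?thesis using 3 unfolding NFix_def by blast
    qed
  qed
  then show ?thesis by blast
qed

lemma A_both:
  "A u (sw k \<circ> w \<circ> sw k) =
    (if Suc k \<in> NFix n w \<and> Suc k \<in> Fix n u then insert k (A u w) else A u w)"
proof -
  have gt: "k < i" if "i \<in> NFix n w" for i using NFix_gt [OF w that] .
  have kn: "k \<in> {1..n}" using both_basic k by simp
  have "i \<in> A u (sw k \<circ> w \<circ> sw k) \<longleftrightarrow>
      i \<in> A u w \<or> (i = k \<and> Suc k \<in> NFix n w \<and> Suc k \<in> Fix n u)" for i
    unfolding A_set_def NFix_both using gt [of i] gt [of "i + 1"] kn by auto
  then show ?thesis by auto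
qed

lemma k_notin_A: "k \<notin> A u w"
  using NFix_gt [OF w, of k] by (auto simp: A_set_def)

text \<open>Each way of lying below s w s but not below w involves a translate by s that moves k,
  except s x s with x fixing k + 1; there s x s = x.\<close>

lemma le_both_fixing:
  assumes "le x (sw k \<circ> w \<circ> sw k)" "\<And>i. i \<le> k \<Longrightarrow> x i = i"
  shows "le x w"
proof -
  have x: "x \<in> W" "sw k \<circ> x \<in> W" using assms le_carrier both_basic k by auto
  have D: "le x w" if "le x (w \<circ> sw k)"
  proof -
    have "\<not> le (x \<circ> sw k) w"
    proof
      assume "le (x \<circ> sw k) w"
      from boolean_from_Suc_D(3) [OF boolean_from_le [OF w this] k] have "x (Suc k) = x k"
        using assms(2) by simp
      then show False using W_inj x by fastforce
    qed
    then show ?thesis using that le_comp_sw_iff x by blast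
  qed
  have "le x (w \<circ> sw k)"
  proof (rule ccontr)
    assume not: "\<not> le x (w \<circ> sw k)"
    then have sx: "le (sw k \<circ> x) (w \<circ> sw k)" using assms(1) le_both_iff x by blast
    then have "le (sw k \<circ> x) w \<or> le (sw k \<circ> x \<circ> sw k) w" using le_comp_sw_iff x by blast
    then show False
    proof
      assume "le (sw k \<circ> x) w"
      from boolean_from_Suc_D(3) [OF boolean_from_le [OF w this] k] show False
        using assms(2) by simp
    next
      assume *: "le (sw k \<circ> x \<circ> sw k) w"
      from boolean_from_Suc_D(3) [OF boolean_from_le [OF w this] k]
      have "sw k (x (Suc k)) = k" by simp
      then have xk: "x (Suc k) = Suc k" by (metis sw_apply(1) sw_sw)
      then have "sw k \<circ> x = x \<circ> sw k" using sw_comp_commute x assms(2) by blast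
      then have "le x w" using * by simp
      then show False using not le_comp_sw_iff x by blast
    qed
  qed
  then show ?thesis using D by blast
qed

text \<open>The length grows by two and A by at most one element. If A grows, x also fixes k + 1, so
  the sharpened bound for w applies; otherwise the ordinary bound, or x = w with A empty,
  suffices.\<close>

lemma both_bound:
  assumes KL: "KL_column w (col w)"
    and bound: "\<And>x. \<lbrakk>Suc k \<in> NFix n w; le x w; \<And>i. i \<le> Suc k \<Longrightarrow> x i = i\<rbrakk>
      \<Longrightarrow> 2 * card (A x w) + 2 + len x \<le> len w"
    and x: "le x (sw k \<circ> w \<circ> sw k)" "\<And>i. i \<le> k \<Longrightarrow> x i = i"
  shows "2 * card (A x (sw k \<circ> w \<circ> sw k)) + 2 + len x \<le> len (sw k \<circ> w \<circ> sw k)"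
proof -
  note b = both_basic
  have len: "len (sw k \<circ> w \<circ> sw k) = len w + 2" using b(8,9) by (simp add: comp_assoc)
  have xw: "le x w" using le_both_fixing x by blast
  show ?thesis
  proof (cases "Suc k \<in> NFix n w \<and> Suc k \<in> Fix n x")
    case True
    then have "x (Suc k) = Suc k"
      using mem_Fix_Suc_iff [OF boolean_from_le [OF w xw] b(5)] by simp
    then have "2 * card (A x w) + 2 + len x \<le> len w"
      using True x(2) xw by (intro bound) (auto simp: le_Suc_eq)
    then show ?thesis using True len by (simp add: A_both k_notin_A)
  next
    case False
    have "2 * card (A x w) + len x \<le> len w"
      using KL_column_colD(3) [OF KL xw] by (cases "x = w") auto
    then show ?thesis using False len by (auto simp: A_both)
  qed
qed

text \<open>The premise \<open>bound\<close> pays for the new factor 1+q when k enters A; the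
  premise \<open>shape\<close> provides the column to be subtracted when it cannot.\<close>

lemma KL_column_col_both:
  assumes KL: "KL_column w (col w)"
    and bound: "\<And>x. \<lbrakk>Suc k \<in> NFix n w; le x w; \<And>i. i \<le> Suc k \<Longrightarrow> x i = i\<rbrakk>
      \<Longrightarrow> 2 * card (A x w) + 2 + len x \<le> len w"
    and shape: "Suc k \<notin> NFix n w \<Longrightarrow> \<exists>y. boolean_from (Suc (Suc k)) y \<and> KL_column y (col y) \<and>
      (w = y \<circ> sw (Suc k) \<or> w = sw (Suc k) \<circ> y)"
  shows "KL_column (sw k \<circ> w \<circ> sw k) (col (sw k \<circ> w \<circ> sw k))"
proof -
  let ?s = "sw k" and ?v = "sw k \<circ> w \<circ> sw k"
  note b = both_basic
  have len: "len ?v = len w + 2" using b(8,9) by (simp add: comp_assoc)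
  have s: "?s \<in> simple_transpositions n" using k b by simp
  have KLs: "KL_column (w \<circ> ?s) (col (w \<circ> ?s))" using KL_column_col_right [OF w k KL] .
  define C where "C = (\<lambda>u. LT ?s (col (w \<circ> ?s)) u + col (w \<circ> ?s) u)"
  have C: "selfdual (len ?v) C"
    using selfdual_LT [OF KL_column_colD(2) [OF KLs] s] b(8) len unfolding C_def by simp
  have C_eq: "C u = (if le u ?v
      then (1 + q) ^ (card (A u w) + (if Suc k \<in> Fix n u then 1 else 0)) else 0)" if "u \<in> W" for u
    using LT_col [OF that] by (simp add: C_def)
  have supp: "supported (col y)" for y
    using le_carrier unfolding supported_def col_def by metis
  have suppC: "supported C" using C by (simp add: selfdual_def)
  have "selfdual (len ?v) (col ?v)"
  proof (cases "Suc k \<in> NFix n w")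
    case True
    have "col ?v = C"
      by (rule supported_eqI [OF supp suppC])
        (use True in \<open>auto simp: C_eq col_def A_both k_notin_A\<close>)
    then show ?thesis using C by simp
  next
    case False
    then obtain y where y: "boolean_from (Suc (Suc k)) y" "KL_column y (col y)"
      "w = y \<circ> sw (Suc k) \<or> w = sw (Suc k) \<circ> y"
      using shape by blast
    have y': "boolean_from (Suc k) y" using boolean_from.keep [OF y(1)] by simp
    note py = boolean_from_Suc_D [OF y(1), simplified]
    note KLy = KL_column_col_right [OF y' k y(2)]
    have lys: "len (y \<circ> ?s) = Suc (len y)"
      using boolean_from_Suc_D [OF y' k] k by (intro len_sw_Suc) auto
    have s': "sw (Suc k) \<in> simple_transpositions n" using py by simp
    have lw: "len w = Suc (len y)"
    proof -
      have "len (y \<circ> sw (Suc k)) = Suc (len y)"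
        using py by (intro len_sw_Suc) auto
      moreover have "len (sw (Suc k) \<circ> y) = Suc (len y)"
      proof -
        have "len (sw (Suc k) \<circ> y) = len (iv y \<circ> sw (Suc k))"
          using len_left [OF py(1) s', unfolded sym_group_mult] .
        also have "\<dots> = Suc (len (iv y))"
          using boolean_from_Suc_D [OF boolean_from_inv [OF y(1)], simplified]
          by (intro len_sw_Suc) auto
        finally show ?thesis using py by simp
      qed
      ultimately show ?thesis using y(3) by auto
    qed
    have NF: "NFix n w = NFix n y"
      using y(3) NFix_comp_sw [OF y(1)] NFix_sw_comp [OF y(1)] by auto
    have Ay: "A u (y \<circ> ?s) = A u w" for u
      using A_cong [OF NFix_comp_sw [OF y' k], of u] A_cong [OF NF, of u] by simp
    \<comment> \<open>The other elements below w are translates by s_(k+1) of elements below y, and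
      such a translate moves k + 1.\<close>
    have le_w_iff: "le x w \<and> x (Suc k) = Suc k \<longleftrightarrow> le x y" for x
    proof
      assume x: "le x w \<and> x (Suc k) = Suc k"
      then have xW: "x \<in> W" using le_carrier by blast
      show "le x y"
      proof (rule ccontr)
        assume not: "\<not> le x y"
        have "le (x \<circ> sw (Suc k)) y \<or> le (sw (Suc k) \<circ> x) y"
          using y(3)
        proof
          assume "w = y \<circ> sw (Suc k)"
          then show ?thesis using x not le_comp_sw_cases [of x y "Suc k"] py by auto
        next
          assume "w = sw (Suc k) \<circ> y"
          then show ?thesis using x not le_sw_comp_cases [of x "Suc k" y] py by auto
        qed
        then show False
        proof
          assume "le (x \<circ> sw (Suc k)) y"
          from boolean_fromD(4) [OF boolean_from_le [OF y(1) this], of "Suc k"]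
          have "x (Suc (Suc k)) = x (Suc k)" using x by simp
          then show False using W_inj [OF xW] by fastforce
        next
          assume "le (sw (Suc k) \<circ> x) y"
          from boolean_fromD(4) [OF boolean_from_le [OF y(1) this], of "Suc k"]
          show False using x by simp
        qed
      qed
    next
      assume x: "le x y"
      have "le y w"
        using y(3)
      proof
        assume "w = y \<circ> sw (Suc k)"
        then show ?thesis
          using le_mult_up [OF py(1) s', unfolded sym_group_mult] lw by simp
      next
        assume "w = sw (Suc k) \<circ> y"
        then show ?thesis
          using le_left_mult_up [OF py(1) s', unfolded sym_group_mult] lw by simp
      qed
      then show "le x w \<and> x (Suc k) = Suc k"
        using x le_trans boolean_fromD(4) [OF boolean_from_le [OF y(1) x]] by blast
    qed
    have le_ys: "le u (y \<circ> ?s) \<longleftrightarrow> le u y \<or> le (u \<circ> ?s) y" if "u \<in> W" for u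
      using that py s lys by (intro le_right_iff) auto
    have fix_x: "Suc k \<in> Fix n u \<longleftrightarrow> x (Suc k) = Suc k" if "le x w" "x = u \<or> x = u \<circ> ?s" for u x
      using mem_Fix_Suc_iff [OF boolean_from_le [OF w that(1)] b(5)] that(2)
        Fix_comp_sw [OF k, of "Suc k" u] by auto
    \<comment> \<open>So the column of y s_k is supported exactly where C has its surplus
      factor.\<close>
    have le_iff: "le u (y \<circ> ?s) \<longleftrightarrow> le u ?v \<and> Suc k \<in> Fix n u" if u: "u \<in> W" for u
    proof
      assume "le u (y \<circ> ?s)"
      then obtain x where x: "le x y" "x = u \<or> x = u \<circ> ?s" using le_ys u by blast
      then have xw: "le x w" "x (Suc k) = Suc k" using le_w_iff by blast+
      then have "le u (w \<circ> ?s)" using x(2) le_comp_sw_iff u by blast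
      then show "le u ?v \<and> Suc k \<in> Fix n u"
        using le_both_iff u fix_x [OF xw(1) x(2)] xw(2) by blast
    next
      assume u': "le u ?v \<and> Suc k \<in> Fix n u"
      have "le u (w \<circ> ?s)"
      proof (rule ccontr)
        assume not: "\<not> le u (w \<circ> ?s)"
        then have "le (?s \<circ> u) (w \<circ> ?s)" using u' le_both_iff u by blast
        moreover have "Suc k \<in> Fix n (?s \<circ> u)"
          using u' Fix_comp_sw [OF k, of "Suc k" u] by simp
        ultimately have "le (?s \<circ> (?s \<circ> u)) (w \<circ> ?s)" using le_comp_sw_fix by blast
        then show False using not by simp
      qed
      then obtain x where x: "le x w" "x = u \<or> x = u \<circ> ?s" using le_comp_sw_iff u by blast
      then have "le x y" using fix_x [OF x] u' le_w_iff by blast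
      then show "le u (y \<circ> ?s)" using x(2) le_ys u by blast
    qed
    \<comment> \<open>On that support this is (1+q)^(a+1) - q (1+q)^a = (1+q)^a; elsewhere the
      subtrahend is 0.\<close>
    have "col ?v = (\<lambda>u. C u - q * col (y \<circ> ?s) u)"
    proof (rule supported_eqI [OF supp])
      show "supported (\<lambda>u. C u - q * col (y \<circ> ?s) u)"
        using suppC supp [of "y \<circ> ?s"] by (simp add: supported_def)
      fix u assume u: "u \<in> W"
      show "col ?v u = C u - q * col (y \<circ> ?s) u"
        using False le_iff [OF u] by (simp add: C_eq [OF u] col_def Ay A_both algebra_simps)
    qed
    \<comment> \<open>y s_k is as long as w, two shorter than \<open>?v\<close>, and the factor q
      shifts the level by two.\<close>
    moreover have "selfdual (len ?v) (\<lambda>u. q * col (y \<circ> ?s) u)"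
      using selfdual_q_mult [OF KL_column_colD(2) [OF KLy]] len lw lys by simp
    ultimately show ?thesis using selfdual_diff C by simp
  qed
  moreover have "2 * card (A u ?v) + 1 + len u \<le> len ?v" if u: "le u ?v" "u \<noteq> ?v" for u
  proof -
    have uW: "u \<in> W" using le_carrier u by blast
    show ?thesis
    proof (cases "Suc k \<in> NFix n w \<and> Suc k \<in> Fix n u")
      case True
      have "le u (w \<circ> ?s)"
      proof (rule ccontr)
        assume not: "\<not> le u (w \<circ> ?s)"
        then have "le (?s \<circ> u) (w \<circ> ?s)" using u le_both_iff uW by blast
        moreover have "Suc k \<in> Fix n (?s \<circ> u)"
          using True Fix_comp_sw [OF k, of "Suc k" u] by simp
        ultimately have "le (?s \<circ> (?s \<circ> u)) (w \<circ> ?s)" using le_comp_sw_fix by blast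
        then show False using not by simp
      qed
      then obtain x where x: "le x w" "u = x \<or> u = x \<circ> ?s"
        using le_comp_sw_E by blast
      note bx = boolean_from_le [OF w x(1)]
      have "Suc k \<in> Fix n x"
        using True x(2) Fix_comp_sw [OF k, of "Suc k" x] by auto
      then have "x (Suc k) = Suc k" using mem_Fix_Suc_iff [OF bx b(5)] by simp
      \<comment> \<open>Since u may be x s, one longer than x, the ordinary bound with + 1 would
        fall short by one here.\<close>
      then have bd: "2 * card (A x w) + 2 + len x \<le> len w"
        using True x boolean_fromD(4) [OF bx] by (intro bound) (auto simp: le_Suc_eq)
      have xW: "x \<in> W" using le_carrier x by blast
      have "len u \<le> Suc (len x)"
        using x(2) len_mult_le [OF xW s, unfolded sym_group_mult] by auto
      moreover have "A u w = A x w" using x(2) A_comp_sw_both by auto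
      ultimately show ?thesis using bd True len by (simp add: A_both k_notin_A)
    next
      case False
      have *: "2 * card (A d w) + 1 + len d \<le> Suc (len w)" if "le d (w \<circ> ?s)" "d \<noteq> w \<circ> ?s" for d
        using KL_column_colD(3) [OF KLs that] b(8) A_comp_sw_both by simp
      have A0: "A (w \<circ> ?s) w = {}" using A_comp_sw_both(3) [of w] by simp
      have "2 * card (A u w) + 1 + len u \<le> len w + 2"
      proof (cases "le u (w \<circ> ?s)")
        case True
        then show ?thesis using * [of u] A0 b(8) by (cases "u = w \<circ> ?s") auto
      next
        case False
        then have su: "le (?s \<circ> u) (w \<circ> ?s)" using u le_both_iff uW by blast
        have "?s \<circ> u \<noteq> w \<circ> ?s"
        proof
          assume "?s \<circ> u = w \<circ> ?s"
          then have "?s \<circ> (?s \<circ> u) = ?v" by (simp only: comp_assoc)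
          then show False using u by simp
        qed
        then have d: "2 * card (A (?s \<circ> u) w) + 1 + len (?s \<circ> u) \<le> Suc (len w)"
          using * su by blast
        have "len u \<le> Suc (len (?s \<circ> u))"
          using len_left_cases [OF uW s, unfolded sym_group_mult] by auto
        then show ?thesis using d A_comp_sw_both(2) [of u] by simp
      qed
      moreover have "A u ?v = A u w" using False by (auto simp: A_both)
      ultimately show ?thesis using len by simp
    qed
  qed
  ultimately show ?thesis using b by (intro KL_column_colI) auto
qed

end

section \<open>Kazhdan--Lusztig polynomials of boolean permutations\<close>

lemma KL_column_id: "KL_column id (col id)"
proof -
  obtain c where c: "KL_column id c" using KL_column_exists [OF id_W] by blast
  have le_id: "le u id \<longleftrightarrow> u = id" for u
    using le_one_iff unfolding sym_group_one .
  have "c = col id"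
  proof
    fix u
    show "c u = col id u"
    proof (cases "u = id")
      case True
      then have "c u = 1" using c unfolding KL_column_def by blast
      then show ?thesis unfolding True col_def le_id by simp
    next
      case False
      then have "c u = 0" using c le_id unfolding KL_column_def by blast
      then show ?thesis using False unfolding col_def le_id by simp
    qed
  qed
  then show ?thesis using c by simp
qed

text \<open>The second part is a sharper form of the degree bound; it makes room for the additional
  factor \<open>1 + q\<close> that appears one level further down.\<close>

lemma KL_column_col_boolean_from:
  assumes "boolean_from k v"
  shows "KL_column v (col v) \<and> (\<forall>x. k \<in> NFix n v \<longrightarrow> le x v \<longrightarrow> (\<forall>i\<le>k. x i = i)
    \<longrightarrow> 2 * card (A x v) + 2 + len x \<le> len v)"
proof -
  have "k \<le> m" using boolean_fromD assms by blast
  then show ?thesis using assms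
  proof (induction arbitrary: v rule: inc_induct)
    case base
    \<comment> \<open>Every other constructor would need an element of level m + 1, and levels are
      at most m.\<close>
    then have "v = id"
      by cases (use boolean_fromD(3) in fastforce)+
    moreover have "NFix n id = {}" by (auto simp: NFix_def Fix_def)
    ultimately show ?case using KL_column_id by blast
  next
    case (step k)
    have IH: "KL_column y (col y)" if "boolean_from (Suc k) y" for y
      using step.IH that by blast
    have bound: "2 * card (A x y) + 2 + len x \<le> len y"
      if "boolean_from (Suc k) y" "Suc k \<in> NFix n y" "le x y" "\<And>i. i \<le> Suc k \<Longrightarrow> x i = i" for x y
      using step.IH [OF that(1)] that by blast
    have k_fix: "k \<notin> NFix n y" if "boolean_from (Suc k) y" for y
      using NFix_gt [OF that, of k] by auto
    from step.prems show ?case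
    proof cases
      case base
      then show ?thesis using step.hyps by simp
    next
      case keep
      then show ?thesis using IH k_fix by blast
    next
      case (right w)
      then have "k \<notin> NFix n v" using k_fix [of w] NFix_comp_sw [of k w] by simp
      then show ?thesis using right KL_column_col_right IH by blast
    next
      case (left w)
      then have "k \<notin> NFix n v" using k_fix [of w] NFix_sw_comp [of k w] by simp
      then show ?thesis using left KL_column_col_left IH by blast
    next
      case (both w)
      note p = boolean_from_Suc_D [OF both(2,3)]
      show ?thesis
      proof (cases "w (Suc k) = Suc k")
        case True
        \<comment> \<open>If w fixes k + 1 the two-sided product is w itself, already settled one
          level up.\<close>
        then have "sw k \<circ> w \<circ> sw k = w"
          using sw_comp_commute [OF p(1)] p(3) by simp
        then show ?thesis using both IH k_fix by simp
      next
        case False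
        \<comment> \<open>The last constructor used for w is determined: \<open>base\<close> and
          \<open>keep\<close> give elements fixing k + 1, and \<open>both\<close> puts k + 1 into
          NFix(w) by \<open>NFix_both\<close>. Only a one-sided product remains.\<close>
        have shape: "\<exists>y. boolean_from (Suc (Suc k)) y \<and> KL_column y (col y) \<and>
            (w = y \<circ> sw (Suc k) \<or> w = sw (Suc k) \<circ> y)" if NF: "Suc k \<notin> NFix n w"
          using both(2)
        proof cases
          case base
          then show ?thesis using False by simp
        next
          case keep
          then show ?thesis using False boolean_fromD(4) [OF keep(1), of "Suc k"] by simp
        next
          case (right y)
          then show ?thesis using IH boolean_from.keep by blast
        next
          case (left y)
          then show ?thesis using IH boolean_from.keep by blast
        next
          case yboth: (both y)
          have "y (Suc (Suc k)) \<noteq> Suc (Suc k)"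
            using False yboth(1) by auto
          then have "Suc k \<in> NFix n w"
            using NFix_both [OF yboth(2,3)] yboth(1) by blast
          then show ?thesis using NF by blast
        qed
        have bound': "2 * card (A x w) + 2 + len x \<le> len w"
          if "Suc k \<in> NFix n w" "le x w" "\<And>i. i \<le> Suc k \<Longrightarrow> x i = i" for x
          using bound [OF both(2) that] .
        note KL = IH [OF both(2)]
        have "KL_column v (col v)"
          unfolding both(1)
        proof (rule KL_column_col_both [OF both(2,3) False KL _ shape])
          show "2 * card (A x w) + 2 + len x \<le> len w"
            if "Suc k \<in> NFix n w" "le x w" "\<And>i. i \<le> Suc k \<Longrightarrow> x i = i" for x
            by (rule bound' [OF that])
        qed
        moreover have "2 * card (A x v) + 2 + len x \<le> len v" if "le x v" "\<forall>i\<le>k. x i = i" for x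
          unfolding both(1)
        proof (rule both_bound [OF both(2,3) False KL])
          show "2 * card (A x w) + 2 + len x \<le> len w"
            if "Suc k \<in> NFix n w" "le x w" "\<And>i. i \<le> Suc k \<Longrightarrow> x i = i" for x
            by (rule bound' [OF that])
        qed (use that both(1) in blast)+
        ultimately show ?thesis by blast
      qed
    qed
  qed
qed

lemma KL_poly_boolean:
  assumes "boolean_element (sym_group m) (simple_transpositions n) v" "le u v"
  shows "KL_poly (sym_group m) (simple_transpositions n) u v = [:1, 1:] ^ card (A_set n u v)"
proof -
  have "KL_column v (col v)"
    using KL_column_col_boolean_from boolean_element_imp_boolean_from assms(1) by blast
  moreover have "1 + q = [:1, 1:]" by (simp add: q_def one_pCons)
  ultimately show ?thesis using KL_poly_eq_column assms(2) by (simp add: col_def)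
qed

end

theorem corollary6:
  fixes n :: nat and \<pi> \<rho> :: "nat \<Rightarrow> nat"
  assumes "n \<ge> 1"
    and "\<pi> \<in> carrier (sym_group (n + 1))"
    and "\<rho> \<in> carrier (sym_group (n + 1))"
    and "boolean_element (sym_group (n + 1)) (simple_transpositions n) \<pi>"
    and "boolean_element (sym_group (n + 1)) (simple_transpositions n) \<rho>"
    and "bruhat_le (sym_group (n + 1)) (simple_transpositions n) \<pi> \<rho>"
  shows "KL_poly (sym_group (n + 1)) (simple_transpositions n) \<pi> \<rho> = [:1, 1:] ^ card (A_set n \<pi> \<rho>)"
proof -
  interpret type_A n "n + 1" by unfold_locales simp
  show ?thesis using KL_poly_boolean assms(5,6) .
qed

end
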